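(* A point $y\in Y'\cap\mathbb{Q}(\zeta)$ has a purely periodic multiplicative coding, with the four digits $\sigma_0,\sigma_1,\sigma_2,\sigma_3$, if and only if $(y,\phi(y))\in Y'\times\mathcal{Y}$.
   Context: Let $\zeta=\exp(2\pi i/5)$ and $\omega=\frac{1+\sqrt5}{2}\in\mathbb{Q}(\zeta)$. Put $d_0=0$, $d_2=\zeta$, $d_3=\zeta/\omega$, $d_5=-\frac{1}{\omega\zeta}$, all in $\mathbb{Z}[\zeta]$. $Y'$ is the unique non-empty compact subset of $\mathbb{C}$ satisfying $Y'=\bigcup_{m\in\{0,2,3,5\}}\left(\frac{\zeta^m}{\omega^2}Y'+d_m\right)$. Multiplicative coding: put $\xi_0=0$, $\xi_1=2$, $\xi_2=3$, $\xi_3=5$. A point $y\in Y'$ has multiplicative coding $\sigma_{k_1}\sigma_{k_2}\sigma_{k_3}\cdots$, with $k_i\in\{0,1,2,3\}$, if with $m_i=\xi_{k_i}$ one has $$y=d_{m_1}+\frac{\zeta^{m_1}}{\omega^2}\left(d_{m_2}+\frac{\zeta^{m_2}}{\omega^2}\left(d_{m_3}+\frac{\zeta^{m_3}}{\omega^2}\left(\cdots\right)\right)\right).$$ (Here $\sigma_0,\sigma_1,\sigma_2,\sigma_3$ are merely symbols for the four digits $d_0,d_2,d_3,d_5$, respectively.) The coding is purely periodic if there is $p\ge1$ with $k_{i+p}=k_i$ for all $i\ge1$. $\phi\in\mathrm{Gal}(\mathbb{Q}(\zeta)/\mathbb{Q})$ is the automorphism with $\phi(\zeta)=\zeta^2$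 (so $\phi(\omega)=-1/\omega$), and $u_i=\phi(d_i)$ for $i\in\{0,2,3,5\}$. The dual attractor $\mathcal{Y}$ is the unique non-empty compact subset of $\mathbb{C}$ satisfying $$\mathcal{Y}=\frac{1}{\omega^2}(\mathcal{Y}-u_0)\cup\frac{\zeta}{\omega^2}(\mathcal{Y}-u_2)\cup\frac{\zeta^{-1}}{\omega^2}(\mathcal{Y}-u_3)\cup\frac{1}{\omega^2}(\mathcal{Y}-u_5).$$ *)

theory Defs
  imports
    "HOL-Analysis.Analysis"
    "HOL-Algebra.Generated_Fields"
    "HOL-Algebra.Algebraic_Closure_Type"
begin

definition zeta :: complex
  where "zeta = exp (2 * of_real pi * \<i> / 5)"

definition omega :: complex
  where "omega = of_real ((1 + sqrt 5) / 2)"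

abbreviation complex_ring :: "complex ring"
  where "complex_ring \<equiv> ring_of_type_algebra"

definition Q_zeta :: "complex set"
  where "Q_zeta = generate_field complex_ring (\<rat> \<union> {zeta})"

text \<open>Maps are total functions on \<^typ>\<open>complex\<close>; an element of the Galois group of
  \<open>L/K\<close> is only determined on \<open>L\<close>, and its values elsewhere are unconstrained.\<close>

definition Gal :: "complex set \<Rightarrow> complex set \<Rightarrow> (complex \<Rightarrow> complex) set"
  where "Gal L K =
    {h \<in> ring_iso (complex_ring\<lparr>carrier := L\<rparr>) (complex_ring\<lparr>carrier := L\<rparr>). \<forall>x\<in>K. h x = x}"

text \<open>Only the values at 0, 2, 3 and 5 are ever used.\<close>

definition d :: "nat \<Rightarrow> complex"
  where "d m = (if m = 2 then zeta
                else if m = 3 then zeta / omega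
                else if m = 5 then - 1 / (omega * zeta)
                else 0)"

text \<open>In both uses below, the map is the union of finitely many similarities of ratio
  \<open>1/omega\<^sup>2 < 1\<close>, so there is exactly one non-empty compact fixed point
  and the description is proper.\<close>

definition attractor :: "(complex set \<Rightarrow> complex set) \<Rightarrow> complex set"
  where "attractor F = (THE Y. Y \<noteq> {} \<and> compact Y \<and> Y = F Y)"

definition Y' :: "complex set"
  where "Y' = attractor (\<lambda>Y. \<Union>m\<in>{0, 2, 3, 5}. (\<lambda>z. zeta ^ m / omega\<^sup>2 * z + d m) ` Y)"

definition dual_attractor :: "(complex \<Rightarrow> complex) \<Rightarrow> complex set"
  where "dual_attractor \<phi> = attractor (\<lambda>Y.
           (\<lambda>z. 1 / omega\<^sup>2 * (z - \<phi> (d 0))) ` Y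
         \<union> (\<lambda>z. zeta / omega\<^sup>2 * (z - \<phi> (d 2))) ` Y
         \<union> (\<lambda>z. inverse zeta / omega\<^sup>2 * (z - \<phi> (d 3))) ` Y
         \<union> (\<lambda>z. 1 / omega\<^sup>2 * (z - \<phi> (d 5))) ` Y)"

definition xi :: "nat \<Rightarrow> nat"
  where "xi k = [0, 2, 3, 5] ! k"

text \<open>The nested expression cut off after \<open>n\<close> digits. Codings are indexed from 0, so
  \<open>k i\<close> is the index of digit number \<open>i + 1\<close>.\<close>

primrec nested :: "nat \<Rightarrow> (nat \<Rightarrow> nat) \<Rightarrow> complex"
  where
    "nested 0 k = 0"
  | "nested (Suc n) k =
       d (xi (k 0)) + zeta ^ xi (k 0) / omega\<^sup>2 * nested n (\<lambda>i. k (Suc i))"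

definition is_mult_coding :: "(nat \<Rightarrow> nat) \<Rightarrow> complex \<Rightarrow> bool"
  where "is_mult_coding k y \<longleftrightarrow>
    (\<forall>i. k i \<in> {0, 1, 2, 3}) \<and> (\<lambda>n. nested n k) \<longlonglongrightarrow> y"

definition purely_periodic :: "(nat \<Rightarrow> nat) \<Rightarrow> bool"
  where "purely_periodic k \<longleftrightarrow> (\<exists>p\<ge>1. \<forall>i. k (i + p) = k i)"

end

theory Submission
  imports Defs
begin

text \<open>
  Write \<open>branch m\<close> for the four similarities whose attractor is \<open>Y'\<close>. Their coefficients
  are units of \<open>\<int>[\<zeta>]\<close> and their translation parts lie in \<open>\<int>[\<zeta>]\<close>, so applying \<open>\<phi>\<close> to them
  makes sense. As \<open>\<phi>\<close> sends \<open>1 / \<omega>\<^sup>2\<close> to \<open>\<omega>\<^sup>2\<close>, the conjugate maps \<open>conj_branch m\<close> are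
  expansions, and the contractions that generate the dual attractor are precisely their
  inverses. Going forward along a branch inside \<open>Y'\<close> is therefore going backward along a dual
  branch for the conjugate point.

  If \<open>y\<close> has a purely periodic coding, its tails \<open>y\<^sub>i\<close> satisfy \<open>y\<^sub>i = branch m (y\<^sub>i\<^sub>+\<^sub>1)\<close> with
  finitely many values, hence \<open>\<phi> y\<^sub>i\<^sub>+\<^sub>1\<close> is the image of \<open>\<phi> y\<^sub>i\<close> under a dual branch. The
  conjugates form a finite set contained in its own image under the dual system, and any
  such bounded set lies in the attractor (\<open>attractor_compare\<close>).

  Conversely, fix a common denominator \<open>N\<close> and let \<open>S\<close> be the set of all \<open>x\<close> in \<open>Y'\<close> with
  \<open>N x\<close> in \<open>\<int>[\<zeta>]\<close> and \<open>\<phi> x\<close> in the dual attractor. All conjugates of points of \<open>S\<close> are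
  bounded, so \<open>S\<close> is finite (\<open>finite_frac_pairs\<close>). The self-similarity of the dual attractor
  gives for each \<open>x\<close> in \<open>S\<close> a digit \<open>m\<close> with \<open>branch m x\<close> again in \<open>S\<close>. This selection is an
  injective map from \<open>S\<close> to itself: \<open>Y'\<close> lies in a trapezoid whose images under different
  branches meet in at most three known points (\<open>branch_overlap\<close>), and the conjugates of
  those points have modulus greater than 1 (\<open>conjugate_contact_norm\<close>) while the dual attractor
  lies in the closed unit disc (\<open>dual_attractor_bounded\<close>). An injective map of a finite set
  permutes it, so \<open>y\<close> lies on a cycle, and reading that cycle backward gives a purely
  periodic coding of \<open>y\<close>.
\<close>

section \<open>Attractors of finite families of contractions\<close>

text \<open>Unfolding \<open>U\<close> a number of times and folding \<open>Y\<close> the same number of times along the same maps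
  brings a point of \<open>Y\<close> arbitrarily close to a given point of \<open>U\<close>. Besides the uniqueness of
  attractors this yields every containment of or in an attractor that is needed below.\<close>
lemma attractor_compare:
  fixes f :: "'i \<Rightarrow> 'a::metric_space \<Rightarrow> 'a"
  assumes contr: "\<And>i x y. i \<in> I \<Longrightarrow> dist (f i x) (f i y) \<le> r * dist x y"
    and r: "0 \<le> r" "r < 1"
    and U: "bounded U" "U \<subseteq> (\<Union>i\<in>I. f i ` U)"
    and Y: "closed Y" "Y \<noteq> {}" "(\<Union>i\<in>I. f i ` Y) \<subseteq> Y"
  shows "U \<subseteq> Y"
proof
  fix x assume "x \<in> U"
  obtain y0 where y0: "y0 \<in> Y" using Y by auto
  obtain D where D: "\<And>x. x \<in> U \<Longrightarrow> dist x y0 \<le> D"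
    using U(1) by (metis bounded_any_center dist_commute)
  have near: "\<exists>y\<in>Y. dist x y \<le> r ^ n * D" if "x \<in> U" for n x
    using that
  proof (induction n arbitrary: x)
    case 0
    then show ?case using y0 D by auto
  next
    case (Suc n)
    obtain i x' where i: "i \<in> I" "x' \<in> U" "x = f i x'" using U(2) Suc.prems by blast
    obtain y where y: "y \<in> Y" "dist x' y \<le> r ^ n * D" using Suc.IH i by blast
    have "dist x (f i y) \<le> r * dist x' y" using contr i by simp
    also have "\<dots> \<le> r * (r ^ n * D)" using y r by (intro mult_left_mono) auto
    finally show ?case using Y(3) i y by (intro bexI[of _ "f i y"]) auto
  qed
  have "\<exists>y\<in>Y. dist y x < e" if "e > 0" for e
  proof -
    have "(\<lambda>n. r ^ n * D) \<longlonglongrightarrow> 0 * D"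
      using r by (intro tendsto_mult LIMSEQ_power_zero tendsto_const) auto
    then have "eventually (\<lambda>n. r ^ n * D < e) sequentially"
      using that by (simp add: order_tendstoD)
    then obtain n where "r ^ n * D < e" by (auto simp: eventually_sequentially)
    moreover obtain y where "y \<in> Y" "dist x y \<le> r ^ n * D" using near \<open>x \<in> U\<close> by blast
    ultimately show ?thesis by (metis dist_commute le_less_trans)
  qed
  then show "x \<in> Y" using Y(1) closed_approachable by blast
qed

text \<open>The attractor is the closure of the orbit of a fixed point \<open>p\<close> of one of the maps: because \<open>p\<close>
  is its own image, the orbit is not only mapped into itself but also covered by its images, and
  both inclusions survive the closure.\<close>
lemma attractor_exists_unique:
  fixes f :: "'i \<Rightarrow> 'a::{complete_space,heine_borel} \<Rightarrow> 'a"
  assumes I: "finite I" "I \<noteq> {}"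
    and contr: "\<And>i x y. i \<in> I \<Longrightarrow> dist (f i x) (f i y) \<le> r * dist x y"
    and r: "0 \<le> r" "r < 1"
  shows "\<exists>!Y. Y \<noteq> {} \<and> compact Y \<and> Y = (\<Union>i\<in>I. f i ` Y)"
proof -
  define F where "F Y = (\<Union>i\<in>I. f i ` Y)" for Y
  have F_mono: "F A \<subseteq> F B" if "A \<subseteq> B" for A B
    using that by (auto simp: F_def)
  obtain j where j: "j \<in> I" using I by auto
  obtain p where p: "f j p = p" using banach_fix_type[OF r, of "f j"] contr j by auto
  \<comment> \<open>With this radius every map sends the ball around \<open>p\<close> into itself.\<close>
  define R where "R = (\<Sum>i\<in>I. dist p (f i p)) / (1 - r)"
  have step: "dist p (f i p) \<le> (1 - r) * R" if "i \<in> I" for i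
    using that r member_le_sum[of i I "\<lambda>i. dist p (f i p)"] I by (simp add: R_def)
  have R: "0 \<le> R" unfolding R_def using r by (intro divide_nonneg_nonneg sum_nonneg) auto
  have ball: "F (cball p R) \<subseteq> cball p R"
  proof (clarsimp simp: F_def)
    fix i x assume i: "i \<in> I" and x: "dist p x \<le> R"
    have "dist p (f i x) \<le> dist p (f i p) + dist (f i p) (f i x)" by (rule dist_triangle)
    also have "\<dots> \<le> (1 - r) * R + r * dist p x" using step contr i by (intro add_mono) auto
    also have "\<dots> \<le> (1 - r) * R + r * R" using x r by (intro add_left_mono mult_left_mono) auto
    finally show "dist p (f i x) \<le> R" by (simp add: algebra_simps)
  qed
  have cont: "continuous_on A (f i)" if "i \<in> I" for A i
    using contr[OF that] r(1)
    by (intro lipschitz_on_continuous_on[of r] lipschitz_onI) auto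
  define orb where "orb = (\<Union>n. (F ^^ n) {p})"
  have p_orb: "p \<in> orb" unfolding orb_def by (rule UN_I[of 0]) auto
  have F_orb: "F orb = (\<Union>n. (F ^^ Suc n) {p})" unfolding orb_def by (auto simp: F_def)
  have orb1: "F orb \<subseteq> orb" unfolding F_orb unfolding orb_def by blast
  have orb2: "orb \<subseteq> F orb"
  proof
    fix x assume "x \<in> orb"
    then obtain n where n: "x \<in> (F ^^ n) {p}" by (auto simp: orb_def)
    show "x \<in> F orb"
    proof (cases n)
      case 0
      then have "x = f j p" using n p by simp
      then show ?thesis using j p_orb by (auto simp: F_def)
    next
      case (Suc m)
      then show ?thesis unfolding F_orb using n by blast
    qed
  qed
  have "(F ^^ n) {p} \<subseteq> cball p R" for n
  proof (induction n)
    case (Suc n)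
    have "F ((F ^^ n) {p}) \<subseteq> F (cball p R)" using Suc.IH by (rule F_mono)
    then show ?case using ball by auto
  qed (use R in auto)
  then have "orb \<subseteq> cball p R" by (auto simp: orb_def)
  then have cpt: "compact (closure orb)"
    using bounded_cball bounded_subset compact_closure by blast
  have sub1: "F (closure orb) \<subseteq> closure orb"
  proof -
    have "f i ` closure orb \<subseteq> closure (f i ` orb)" if "i \<in> I" for i
      by (rule image_closure_subset[OF cont[OF that]]) (auto simp: closure_subset)
    moreover have "closure (f i ` orb) \<subseteq> closure orb" if "i \<in> I" for i
      using orb1 that by (intro closure_mono) (auto simp: F_def)
    ultimately show ?thesis by (fastforce simp: F_def)
  qed
  have "compact (F (closure orb))"
    unfolding F_def using I cont cpt by (intro compact_UN compact_continuous_image) auto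
  moreover have "orb \<subseteq> F (closure orb)" using orb2 closure_subset[of orb] by (fastforce simp: F_def)
  ultimately have sub2: "closure orb \<subseteq> F (closure orb)"
    by (intro closure_minimal compact_imp_closed)
  show ?thesis
  proof (rule ex1I[of _ "closure orb"])
    show "closure orb \<noteq> {} \<and> compact (closure orb) \<and> closure orb = (\<Union>i\<in>I. f i ` closure orb)"
      using p_orb cpt subset_antisym[OF sub2 sub1] closure_subset[of orb]
      unfolding F_def by blast
    fix Y assume Y: "Y \<noteq> {} \<and> compact Y \<and> Y = (\<Union>i\<in>I. f i ` Y)"
    from Y have Y': "Y \<noteq> {}" "compact Y" "Y \<subseteq> F Y" "F Y \<subseteq> Y"
      unfolding F_def by blast+
    note compare = attractor_compare[where I = I and f = f and r = r, OF contr r, folded F_def]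
    show "Y = closure orb"
    proof
      show "Y \<subseteq> closure orb"
        by (rule compare) (use Y' p_orb sub1 closure_subset[of orb] compact_imp_bounded in blast)+
      show "closure orb \<subseteq> Y"
        by (rule compare) (use Y' cpt sub2 compact_imp_bounded compact_imp_closed in blast)+
    qed
  qed
qed

corollary attractor_properties:
  fixes f :: "'i \<Rightarrow> complex \<Rightarrow> complex"
  assumes "finite I" "I \<noteq> {}"
    and "\<And>i x y. i \<in> I \<Longrightarrow> dist (f i x) (f i y) \<le> r * dist x y"
    and "0 \<le> r" "r < 1"
  defines "Y \<equiv> attractor (\<lambda>Y. \<Union>i\<in>I. f i ` Y)"
  shows "Y \<noteq> {}" "compact Y" "Y = (\<Union>i\<in>I. f i ` Y)"
proof -
  have "Y \<noteq> {} \<and> compact Y \<and> Y = (\<Union>i\<in>I. f i ` Y)"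
    unfolding Y_def attractor_def
    by (rule theI', rule attractor_exists_unique[where f = f and r = r]) (fact assms)+
  then show "Y \<noteq> {}" "compact Y" "Y = (\<Union>i\<in>I. f i ` Y)"
    by - (elim conjE, assumption)+
qed

section \<open>The golden ratio and the fifth root of unity\<close>

text \<open>The reciprocal of \<open>\<omega>\<close>, through which \<open>\<omega>\<close> enters all the maps.\<close>
definition tau :: real where "tau = (sqrt 5 - 1) / 2"

lemma tau_sq: "tau * tau = 1 - tau"
  by (simp add: tau_def field_simps)

lemma tau_bounds: "3 / 5 < tau" "tau < 13 / 21"
proof -
  have "sqrt 5 > 22 / 10" by (rule real_less_rsqrt) (simp add: power2_eq_square)
  then show "3 / 5 < tau" by (simp add: tau_def)
  have "sqrt 5 < 47 / 21" by (rule real_less_lsqrt) (simp_all add: power2_eq_square)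
  then show "tau < 13 / 21" by (simp add: tau_def)
qed

lemma zeta_cis: "zeta = cis (2 * pi / 5)"
  by (simp add: zeta_def cis_conv_exp mult_ac)

lemma zeta_5: "zeta ^ 5 = 1"
proof -
  have "cis (2 * pi / 5) ^ 5 = cis (real 5 * (2 * pi / 5))" by (rule Complex.DeMoivre)
  then show ?thesis by (simp add: zeta_cis)
qed

lemma norm_zeta [simp]: "norm zeta = 1"
  by (simp add: zeta_cis)

lemma zeta_nonzero [simp]: "zeta \<noteq> 0"
  using norm_zeta by force

lemma zeta_cyclotomic: "zeta ^ 4 = - 1 - zeta - zeta ^ 2 - zeta ^ 3"
proof -
  have "zeta \<noteq> 1"
  proof
    assume "zeta = 1"
    then have "sin (2 * pi / 5) = 0" by (metis Im_complex_of_real cis.simps(2) of_real_1 zeta_cis)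
    moreover have "sin (2 * pi / 5) > 0" by (rule sin_gt_zero) (auto simp: field_simps)
    ultimately show False by simp
  qed
  moreover have "(zeta - 1) * (1 + zeta + zeta ^ 2 + zeta ^ 3 + zeta ^ 4) = 0"
    using zeta_5 by (simp add: algebra_simps eval_nat_numeral)
  ultimately have "1 + zeta + zeta ^ 2 + zeta ^ 3 + zeta ^ 4 = 0" by simp
  then show ?thesis by (simp add: algebra_simps eq_neg_iff_add_eq_0)
qed

lemma cnj_zeta: "cnj zeta = zeta ^ 4"
proof -
  have "cnj zeta * zeta = 1"
    using complex_norm_square[of zeta] by (simp add: mult.commute)
  also have "1 = zeta ^ 4 * zeta" using zeta_5 by (simp add: eval_nat_numeral mult.assoc)
  finally show ?thesis by simp
qed

text \<open>Both sides are the positive root of \<open>c\<^sup>2 = 1 - c\<close>.\<close>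
lemma tau_zeta: "of_real tau = zeta + zeta ^ 4"
proof -
  define c where "c = 2 * cos (2 * pi / 5)"
  have eq: "zeta + zeta ^ 4 = of_real c"
    unfolding cnj_zeta[symmetric] complex_add_cnj by (simp add: zeta_cis c_def)
  have "(zeta + zeta ^ 4) ^ 2 = 1 - (zeta + zeta ^ 4)"
  proof -
    \<comment> \<open>The correction term is a multiple of the fifth cyclotomic polynomial.\<close>
    have "(zeta + zeta ^ 4) ^ 2 = 1 - (zeta + zeta ^ 4) +
      (1 + zeta + zeta ^ 2 + zeta ^ 3 + zeta ^ 4) * (1 + (zeta - 1) * (zeta ^ 3 + 2))"
      by Groebner_Basis.algebra
    then show ?thesis by (simp add: zeta_cyclotomic)
  qed
  then have "of_real (c ^ 2) = (of_real (1 - c) :: complex)" by (simp add: eq)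
  then have c2: "c ^ 2 = 1 - c" using of_real_eq_iff by blast
  have "cos (2 * pi / 5) > 0" by (rule cos_gt_zero) (auto simp: field_simps)
  then have "c > 0" by (simp add: c_def)
  have "(c - tau) * (c + tau + 1) = (c ^ 2 - (1 - c)) - (tau * tau - (1 - tau))"
    by (simp add: algebra_simps power2_eq_square)
  then have "(c - tau) * (c + tau + 1) = 0" using c2 tau_sq by simp
  then have "c = tau" using \<open>c > 0\<close> tau_bounds by auto
  then show ?thesis using eq by simp
qed

lemma inverse_omega: "1 / omega = of_real tau"
proof -
  have "1 / ((1 + sqrt 5) / 2) = tau"
  proof -
    have "(1 + sqrt 5) / 2 * tau = 1" by (simp add: tau_def field_simps)
    then show ?thesis by (metis inverse_eq_divide inverse_unique)
  qed
  then show ?thesis unfolding omega_def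
    by (metis of_real_1 of_real_divide)
qed

section \<open>Pairs of conjugate cyclotomic integers\<close>

definition cyc :: "int \<Rightarrow> int \<Rightarrow> int \<Rightarrow> int \<Rightarrow> complex \<Rightarrow> complex" where
  "cyc a b c e z = of_int a + of_int b * z + of_int c * z ^ 2 + of_int e * z ^ 3"

text \<open>The graph of \<open>\<zeta> \<mapsto> \<zeta>\<^sup>2\<close> on \<open>\<int>[\<zeta>]\<close>, expressed without an automorphism: arithmetic closure can be
  established for both components at once, before any \<open>\<phi>\<close> is chosen.\<close>
definition conj_pair :: "complex \<Rightarrow> complex \<Rightarrow> bool" where
  "conj_pair x x' \<longleftrightarrow> (\<exists>a b c e. x = cyc a b c e zeta \<and> x' = cyc a b c e (zeta\<^sup>2))"

lemma conj_zeta_cyclotomic: "(zeta\<^sup>2) ^ 4 = - 1 - zeta\<^sup>2 - (zeta\<^sup>2) ^ 2 - (zeta\<^sup>2) ^ 3"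
proof -
  have "(zeta\<^sup>2) ^ 4 = - 1 - zeta\<^sup>2 - (zeta\<^sup>2) ^ 2 - (zeta\<^sup>2) ^ 3 +
    (1 + zeta + zeta ^ 2 + zeta ^ 3 + zeta ^ 4) * (1 - zeta + zeta ^ 2 - zeta ^ 3 + zeta ^ 4)"
    by Groebner_Basis.algebra
  then show ?thesis by (simp add: zeta_cyclotomic)
qed

lemma conj_pair_of_int: "conj_pair (of_int n) (of_int n)"
  unfolding conj_pair_def by (rule exI[of _ n], (rule exI[of _ 0])+) (simp add: cyc_def)

lemma conj_pair_zeta: "conj_pair zeta (zeta\<^sup>2)"
  unfolding conj_pair_def by (rule exI[of _ 0], rule exI[of _ 1], (rule exI[of _ 0])+) (simp add: cyc_def)

lemma conj_pair_add:
  assumes "conj_pair x x'" "conj_pair y y'"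
  shows "conj_pair (x + y) (x' + y')"
proof -
  obtain a b c e where x: "x = cyc a b c e zeta" "x' = cyc a b c e (zeta\<^sup>2)"
    using assms unfolding conj_pair_def by blast
  obtain a' b' c' e' where y: "y = cyc a' b' c' e' zeta" "y' = cyc a' b' c' e' (zeta\<^sup>2)"
    using assms unfolding conj_pair_def by blast
  show ?thesis unfolding conj_pair_def x y
    by (rule exI[of _ "a + a'"], rule exI[of _ "b + b'"], rule exI[of _ "c + c'"],
        rule exI[of _ "e + e'"]) (simp add: cyc_def algebra_simps)
qed

text \<open>Holds at every primitive fifth root of unity with the same coefficients on the right-hand side,
  which is what makes \<^const>\<open>conj_pair\<close> multiplicative.\<close>
lemma cyc_mult:
  assumes "z ^ 4 = - 1 - z - z ^ 2 - z ^ 3"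
  shows "cyc a b c e z * cyc a' b' c' e' z =
    cyc (a * a' + c * e' + e * c' - (b * e' + c * c' + e * b'))
        (a * b' + b * a' + e * e' - (b * e' + c * c' + e * b'))
        (a * c' + b * b' + c * a' - (b * e' + c * c' + e * b'))
        (a * e' + b * c' + c * b' + e * a' - (b * e' + c * c' + e * b')) z"
    (is "_ = ?rhs")
proof -
  \<comment> \<open>The quotient in the polynomial division of the product by \<open>1 + z + z\<^sup>2 + z\<^sup>3 + z\<^sup>4\<close>.\<close>
  define P where "P = of_int (b * e' + c * c' + e * b') + of_int (c * e' + e * c') * (z - 1)
    + of_int (e * e') * (z\<^sup>2 - z)"
  have "cyc a b c e z * cyc a' b' c' e' z = ?rhs + P * (1 + z + z ^ 2 + z ^ 3 + z ^ 4)"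
    unfolding cyc_def P_def of_int_add of_int_mult of_int_diff by Groebner_Basis.algebra
  then show ?thesis using assms by simp
qed

lemma conj_pair_mult: "conj_pair (x * y) (x' * y')" if "conj_pair x x'" "conj_pair y y'"
  using that cyc_mult[OF zeta_cyclotomic] cyc_mult[OF conj_zeta_cyclotomic] unfolding conj_pair_def by metis

lemma conj_pair_uminus: "conj_pair (- x) (- x')" if "conj_pair x x'"
  using conj_pair_mult[OF conj_pair_of_int[of "-1"] that] by simp

lemma conj_pair_power: "conj_pair (x ^ n) (x' ^ n)" if "conj_pair x x'"
  using conj_pair_of_int[of 1] conj_pair_mult[OF that] by (induction n) auto

lemma cnj_cyc_zeta: "cnj (cyc a b c e zeta) = cyc (a - b) (- b) (e - b) (c - b) zeta"
proof -
  have "cnj (cyc a b c e zeta) = cyc a b c e (zeta ^ 4)"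
    by (simp add: cyc_def cnj_zeta)
  also have "\<dots> = cyc (a - b) (- b) (e - b) (c - b) zeta"
  proof -
    have "(zeta ^ 4) ^ 2 = zeta ^ 5 * zeta ^ 3" "(zeta ^ 4) ^ 3 = zeta ^ 5 * zeta ^ 5 * zeta ^ 2"
      by (simp_all flip: power_add power_mult)
    then have "(zeta ^ 4) ^ 2 = zeta ^ 3" "(zeta ^ 4) ^ 3 = zeta ^ 2" by (simp_all add: zeta_5)
    then show ?thesis unfolding cyc_def zeta_cyclotomic by (simp add: algebra_simps)
  qed
  finally show ?thesis .
qed

text \<open>The form is odd unless both arguments are even, so descent by halving applies. It is the norm
  form of \<open>\<int>[\<omega>]\<close>.\<close>
lemma golden_form_anisotropic:
  fixes u v :: int
  assumes "u\<^sup>2 - u * v - v\<^sup>2 = 0"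
  shows "u = 0 \<and> v = 0"
  using assms
proof (induction "nat (\<bar>u\<bar> + \<bar>v\<bar>)" arbitrary: u v rule: less_induct)
  case less
  show ?case
  proof (rule ccontr)
    assume nz: "\<not> (u = 0 \<and> v = 0)"
    have "even (u\<^sup>2 - u * v - v\<^sup>2)" using less.prems by simp
    then have "even u" "even v" by auto
    then obtain u' v' where uv: "u = 2 * u'" "v = 2 * v'" by (auto elim!: evenE)
    have "nat (\<bar>u'\<bar> + \<bar>v'\<bar>) < nat (\<bar>u\<bar> + \<bar>v\<bar>)" using nz uv by arith
    moreover have "4 * (u'\<^sup>2 - u' * v' - v'\<^sup>2) = 0" using less.prems unfolding uv by Groebner_Basis.algebra
    ultimately have "u' = 0 \<and> v' = 0" using less.hyps[of u' v'] by simp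
    then show False using nz uv by simp
  qed
qed

lemma cyc_cong: "a = a' \<Longrightarrow> b = b' \<Longrightarrow> c = c' \<Longrightarrow> e = e' \<Longrightarrow> cyc a b c e z = cyc a' b' c' e' z"
  by simp

text \<open>The product \<open>x * cnj x\<close> lies in the real subring \<open>\<int>[tau]\<close>; multiplying it by its conjugate there
  gives the norm of \<open>x\<close>, an integer that is non-zero by the anisotropy above.\<close>
lemma inverse_cyc:
  assumes "x = cyc a b c e zeta" "x \<noteq> 0"
  shows "\<exists>y y' n. n \<noteq> 0 \<and> conj_pair y y' \<and> inverse x = y / of_int n"
proof -
  define u where "u = a\<^sup>2 + b\<^sup>2 + c\<^sup>2 + e\<^sup>2 - (a * c + b * e + a * e)"
  define v where "v = a * b + b * c + c * e - (a * c + b * e + a * e)"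
  define n where "n = u\<^sup>2 - u * v - v\<^sup>2"
  \<comment> \<open>Here \<open>x * cnj x = u + v * tau\<close>, and \<open>s = u + v * (- 1 - tau)\<close> is its conjugate.\<close>
  define s where "s = cyc u 0 v v zeta"
  have prod: "x * cnj x = cyc (u - v) 0 (- v) (- v) zeta"
    unfolding assms cnj_cyc_zeta cyc_mult[OF zeta_cyclotomic]
    by (rule cyc_cong) (simp_all add: u_def v_def power2_eq_square algebra_simps)
  have "x * cnj x * s = cyc n 0 0 0 zeta"
    unfolding prod s_def cyc_mult[OF zeta_cyclotomic]
    by (rule cyc_cong) (simp_all add: n_def power2_eq_square algebra_simps)
  then have norm: "x * cnj x * s = of_int n" by (simp add: cyc_def)
  have "x * cnj x \<noteq> 0" using assms by simp
  then have "\<not> (u = 0 \<and> v = 0)" using prod by (auto simp: cyc_def)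
  then have n: "n \<noteq> 0" using golden_form_anisotropic unfolding n_def by blast
  have "\<exists>y'. conj_pair (cnj x) y'"
    unfolding assms cnj_cyc_zeta conj_pair_def by blast
  moreover have "\<exists>y'. conj_pair s y'"
    unfolding s_def conj_pair_def by blast
  ultimately obtain y' where "conj_pair (cnj x * s) y'" using conj_pair_mult by blast
  moreover have "inverse x = cnj x * s / of_int n"
    using norm n assms(2) by (simp add: field_simps)
  ultimately show ?thesis using n by blast
qed

section \<open>The cyclotomic field\<close>

lemma Q_zeta_one: "1 \<in> Q_zeta"
  using generate_field.one[of complex_ring] by (simp add: Q_zeta_def ring_of_type_algebra_def)

lemma Q_zeta_Rats: "x \<in> \<rat> \<Longrightarrow> x \<in> Q_zeta"
  by (simp add: Q_zeta_def generate_field.incl)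

lemma Q_zeta_zeta: "zeta \<in> Q_zeta"
  by (simp add: Q_zeta_def generate_field.incl)

lemma Q_zeta_add: "x \<in> Q_zeta \<Longrightarrow> y \<in> Q_zeta \<Longrightarrow> x + y \<in> Q_zeta"
  using generate_field.eng_add[of _ complex_ring] by (simp add: Q_zeta_def ring_of_type_algebra_def)

lemma Q_zeta_mult: "x \<in> Q_zeta \<Longrightarrow> y \<in> Q_zeta \<Longrightarrow> x * y \<in> Q_zeta"
  using generate_field.eng_mult[of _ complex_ring] by (simp add: Q_zeta_def ring_of_type_algebra_def)

lemma Q_zeta_power: "x \<in> Q_zeta \<Longrightarrow> x ^ n \<in> Q_zeta"
  by (induction n) (auto simp: Q_zeta_one Q_zeta_mult)

lemma Q_zeta_of_int: "of_int n \<in> Q_zeta"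
  by (simp add: Q_zeta_Rats)

lemma complex_ring_minus: "\<ominus>\<^bsub>complex_ring\<^esub> x = - x"
proof -
  interpret ring complex_ring by (rule ring_from_type_algebra)
  show ?thesis
    by (rule minus_equality) (simp_all add: ring_of_type_algebra_def)
qed

lemma complex_ring_inverse: "x \<noteq> 0 \<Longrightarrow> inv\<^bsub>complex_ring\<^esub> x = inverse x"
proof -
  interpret field complex_ring by (rule field_from_type_algebra)
  assume "x \<noteq> 0"
  then show ?thesis
    by (intro comm_inv_char) (simp_all add: ring_of_type_algebra_def)
qed

text \<open>Quotients of elements of \<open>\<int>[\<zeta>]\<close> by non-zero integers already form a field, by the norm argument
  of \<open>inverse_cyc\<close>.\<close>
lemma Q_zeta_denominator:
  assumes "x \<in> Q_zeta"
  obtains N a b c e where "N \<noteq> 0" "of_int N * x = cyc a b c e zeta"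
proof -
  define P where "P x \<longleftrightarrow> (\<exists>N x'. N \<noteq> 0 \<and> conj_pair (of_int N * x) x')" for x
  have "P x" using assms unfolding Q_zeta_def
  proof (induction rule: generate_field.induct)
    case one
    then show ?case using conj_pair_of_int[of 1] unfolding P_def
      by (intro exI[of _ 1]) (auto simp: ring_of_type_algebra_def)
  next
    case (incl h)
    then consider "h \<in> \<rat>" | "h = zeta" by auto
    then show ?case
    proof cases
      case 1
      then obtain p q where "q > 0" "h = of_int p / of_int q" by (auto elim!: Rats_cases')
      then show ?thesis using conj_pair_of_int[of p] unfolding P_def by (intro exI[of _ q]) auto
    next
      case 2
      then show ?thesis using conj_pair_zeta unfolding P_def
        by (intro exI[of _ 1] exI[of _ "zeta\<^sup>2"]) auto
    qed
  next
    case (a_inv h)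
    then show ?case unfolding P_def complex_ring_minus using conj_pair_uminus
      by (metis mult_minus_right)
  next
    case (m_inv h)
    then have h: "h \<noteq> 0" by (simp add: ring_of_type_algebra_def)
    obtain N x' where N: "N \<noteq> 0" "conj_pair (of_int N * h) x'" using m_inv unfolding P_def by blast
    then obtain y y' n where y: "n \<noteq> 0" "conj_pair y y'" "inverse (of_int N * h) = y / of_int n"
      using inverse_cyc h unfolding conj_pair_def
      by (metis (no_types, opaque_lifting) no_zero_divisors of_int_eq_0_iff)
    have "of_int n * inverse h = of_int N * y"
      using y h N by (simp add: field_simps)
    then have "conj_pair (of_int n * inverse h) (of_int N * y')"
      using conj_pair_mult conj_pair_of_int y by simp
    then show ?case unfolding P_def complex_ring_inverse[OF h] using y by blast
  next
    case (eng_add x y)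
    then obtain N x' M y' where N: "N \<noteq> 0" "conj_pair (of_int N * x) x'" "M \<noteq> 0" "conj_pair (of_int M * y) y'"
      unfolding P_def by blast
    have "conj_pair (of_int M * (of_int N * x) + of_int N * (of_int M * y)) (of_int M * x' + of_int N * y')"
      by (intro conj_pair_add conj_pair_mult N conj_pair_of_int)
    then have "conj_pair (of_int (M * N) * (x + y)) (of_int M * x' + of_int N * y')"
      by (simp add: algebra_simps)
    then show ?case using N unfolding P_def
      by (intro exI[of _ "M * N"]) (auto simp: ring_of_type_algebra_def)
  next
    case (eng_mult x y)
    then obtain N x' M y' where N: "N \<noteq> 0" "conj_pair (of_int N * x) x'" "M \<noteq> 0" "conj_pair (of_int M * y) y'"
      unfolding P_def by blast
    have "conj_pair ((of_int N * x) * (of_int M * y)) (x' * y')"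
      by (intro conj_pair_mult N)
    then have "conj_pair (of_int (M * N) * (x * y)) (x' * y')"
      by (simp add: algebra_simps)
    then show ?case using N unfolding P_def
      by (intro exI[of _ "M * N"]) (auto simp: ring_of_type_algebra_def)
  qed
  then show thesis using that unfolding P_def conj_pair_def by blast
qed

section \<open>A trapezoid that contains the attractor\<close>

abbreviation digits :: "nat set" where "digits \<equiv> {0, 2, 3, 5}"

definition branch :: "nat \<Rightarrow> complex \<Rightarrow> complex" where
  "branch m z = of_real (tau\<^sup>2) * zeta ^ m * z + d m"

lemma zeta_sq: "zeta\<^sup>2 = of_real tau * zeta - 1"
  using zeta_5 unfolding tau_zeta by (simp add: eval_nat_numeral algebra_simps)

lemma Im_zeta: "Im zeta > 0"
  unfolding zeta_cis by (simp add: sin_gt_zero)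

text \<open>For non-real \<open>w\<close>, every \<open>z\<close> equals \<open>coord_one w z + coord_dir w z * w\<close>. In the basis \<open>1, w\<close>,
  multiplication by a fifth root of unity \<open>w\<close> has its matrix entries in \<open>\<rat>(tau)\<close>, so that no
  trigonometry is left.\<close>
definition coord_dir :: "complex \<Rightarrow> complex \<Rightarrow> real" where "coord_dir w z = Im z / Im w"
definition coord_one :: "complex \<Rightarrow> complex \<Rightarrow> real" where "coord_one w z = Re z - coord_dir w z * Re w"

lemma coord_eqI: "coord_one w x = coord_one w y \<Longrightarrow> coord_dir w x = coord_dir w y \<Longrightarrow> Im w \<noteq> 0 \<Longrightarrow> x = y"
  by (simp add: coord_one_def coord_dir_def complex_eq_iff)

lemma coord_add [simp]: "coord_one w (x + y) = coord_one w x + coord_one w y" "coord_dir w (x + y) = coord_dir w x + coord_dir w y"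
  by (simp_all add: coord_one_def coord_dir_def add_divide_distrib algebra_simps)

lemma coord_diff [simp]: "coord_one w (x - y) = coord_one w x - coord_one w y" "coord_dir w (x - y) = coord_dir w x - coord_dir w y"
  by (simp_all add: coord_one_def coord_dir_def diff_divide_distrib algebra_simps)

lemma coord_scale [simp]: "coord_one w (of_real r * x) = r * coord_one w x" "coord_dir w (of_real r * x) = r * coord_dir w x"
  by (simp_all add: coord_one_def coord_dir_def algebra_simps)

lemma coord_of_real [simp]: "coord_one w (of_real r) = r" "coord_dir w (of_real r) = 0"
  by (simp_all add: coord_one_def coord_dir_def)

lemma coord_const [simp]: "coord_one w 0 = 0" "coord_dir w 0 = 0" "coord_one w 1 = 1" "coord_dir w 1 = 0"
  by (simp_all add: coord_one_def coord_dir_def)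

lemma coord_base:
  assumes "Im w \<noteq> 0"
  shows "coord_one w w = 0" "coord_dir w w = 1"
  using assms by (simp_all add: coord_one_def coord_dir_def)

lemma coord_rotate:
  assumes "Im w \<noteq> 0" "w\<^sup>2 = of_real k * w - 1"
  shows "coord_one w (w * z) = - coord_dir w z" "coord_dir w (w * z) = coord_one w z + k * coord_dir w z"
proof -
  have z: "z = of_real (coord_one w z) + of_real (coord_dir w z) * w"
    using assms(1) by (intro coord_eqI[of w]) (simp_all add: coord_base)
  have "w * z = w * (of_real (coord_one w z) + of_real (coord_dir w z) * w)" by (subst z) (rule refl)
  also have "\<dots> = of_real (coord_one w z) * w + of_real (coord_dir w z) * w\<^sup>2"
    by (simp add: power2_eq_square algebra_simps)
  also have "\<dots> = of_real (coord_one w z + k * coord_dir w z) * w + of_real (- coord_dir w z)"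
    unfolding assms(2) by (simp add: algebra_simps)
  finally have e: "w * z = of_real (coord_one w z + k * coord_dir w z) * w + of_real (- coord_dir w z)" .
  show "coord_one w (w * z) = - coord_dir w z" "coord_dir w (w * z) = coord_one w z + k * coord_dir w z"
    unfolding e by (simp_all only: coord_add coord_scale coord_of_real coord_base[OF assms(1)]) simp_all
qed

lemmas coord_zeta [simp] =
  coord_rotate[OF less_imp_neq[OF Im_zeta, symmetric] zeta_sq]
  coord_base[OF less_imp_neq[OF Im_zeta, symmetric]]

lemma tau_tau [simp]: "tau * (tau * x) = x - tau * x"
proof -
  have "tau * (tau * x) = tau * tau * x" by simp
  then show ?thesis by (simp only: tau_sq) (simp add: algebra_simps)
qed

lemma d_values: "d 0 = 0" "d 2 = zeta" "d 3 = of_real tau * zeta"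
  "d 5 = of_real tau * zeta - of_real (1 - tau)"
proof -
  show "d 0 = 0" "d 2 = zeta" by (simp_all add: d_def)
  have "d 3 = 1 / omega * zeta" by (simp add: d_def)
  then show "d 3 = of_real tau * zeta" by (simp only: inverse_omega)
  have "zeta * (of_real tau - zeta) = 1" using zeta_sq by (simp add: algebra_simps power2_eq_square)
  then have z: "inverse zeta = of_real tau - zeta" by (rule inverse_unique)
  have "d 5 = - (1 / omega * inverse zeta)" by (simp add: d_def divide_inverse)
  also have "\<dots> = - (of_real tau * (of_real tau - zeta))" by (simp only: z inverse_omega)
  also have "\<dots> = of_real tau * zeta - of_real (tau * tau)" by (simp add: algebra_simps)
  finally show "d 5 = of_real tau * zeta - of_real (1 - tau)" by (simp only: tau_sq)
qed

abbreviation "s_of \<equiv> coord_one zeta"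
abbreviation "t_of \<equiv> coord_dir zeta"

lemma zeta_power_mult: "zeta ^ 2 * z = zeta * (zeta * z)" "zeta ^ 3 * z = zeta * (zeta * (zeta * z))"
  "zeta ^ 5 * z = z"
  by (simp_all only: zeta_5) (simp_all add: eval_nat_numeral mult.assoc)

lemma branch_coords:
  "s_of (branch 0 z) = s_of z - tau * s_of z"
  "t_of (branch 0 z) = t_of z - tau * t_of z"
  "s_of (branch 2 z) = t_of z - s_of z + tau * s_of z - 2 * (tau * t_of z)"
  "t_of (branch 2 z) = 1 + 2 * (tau * s_of z) - 2 * (tau * t_of z) - s_of z + t_of z"
  "s_of (branch 3 z) = 2 * (tau * t_of z) - 2 * (tau * s_of z) + s_of z - t_of z"
  "t_of (branch 3 z) = tau - 2 * (tau * s_of z) + tau * t_of z + s_of z - t_of z"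
  "s_of (branch 5 z) = s_of z - tau * s_of z - (1 - tau)"
  "t_of (branch 5 z) = t_of z - tau * t_of z + tau"
  unfolding branch_def mult.assoc zeta_power_mult d_values power2_eq_square tau_sq
    coord_add coord_diff coord_scale coord_zeta coord_of_real coord_const power_0 mult_1
  by (simp_all add: algebra_simps)

lemma tau_powers: "tau ^ 2 = 1 - tau" "tau ^ 3 = 2 * tau - 1" "tau ^ 4 = 2 - 3 * tau"
  by (simp_all add: eval_nat_numeral tau_sq algebra_simps)

lemma tau_pos: "0 < tau" "tau < 1"
  using tau_bounds by auto

text \<open>The trapezoid is the convex hull of \<open>- inverse zeta\<close>, \<open>0\<close>, \<open>tau\<^sup>2 * (1 + zeta)\<close> and \<open>zeta\<close>. Each functional
  vanishes on the line through one side and is positive inside.\<close>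
definition edge1 :: "complex \<Rightarrow> real" where "edge1 z = s_of z + tau * t_of z"
definition edge2 :: "complex \<Rightarrow> real" where "edge2 z = tau - edge1 z"
definition edge3 :: "complex \<Rightarrow> real" where "edge3 z = t_of z - s_of z"
definition edge4 :: "complex \<Rightarrow> real" where "edge4 z = 1 - t_of z"

lemmas edge_defs = edge1_def edge2_def edge3_def edge4_def

definition trapezoid :: "complex set" where
  "trapezoid = {z. 0 \<le> edge1 z \<and> 0 \<le> edge2 z \<and> 0 \<le> edge3 z \<and> 0 \<le> edge4 z}"

lemma closed_trapezoid: "closed trapezoid"
  unfolding trapezoid_def edge_defs coord_one_def coord_dir_def using Im_zeta
  by (intro closed_Collect_conj closed_Collect_le continuous_intros) auto

lemma edge_relation: "edge4 z = 1 - tau * edge1 z - tau * edge3 z"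
  by (simp add: edge_defs algebra_simps)

lemma edge_eqI: "edge3 x = edge3 y \<Longrightarrow> edge4 x = edge4 y \<Longrightarrow> x = y"
  by (rule coord_eqI[of zeta]) (use Im_zeta in \<open>auto simp: edge_defs\<close>)

text \<open>The point of these formulas is that all coefficients are non-negative, which is the invariance of
  the trapezoid.\<close>
lemma edge_branch:
  "edge1 (branch 0 z) = tau ^ 2 * edge1 z"
  "edge2 (branch 0 z) = tau ^ 2 + tau ^ 2 * edge2 z"
  "edge3 (branch 0 z) = tau ^ 2 * edge3 z"
  "edge4 (branch 0 z) = tau + tau ^ 2 * edge4 z"
  "edge1 (branch 2 z) = tau ^ 3 + tau ^ 3 * edge2 z + tau ^ 3 * edge4 z"
  "edge2 (branch 2 z) = tau ^ 2 * edge1 z + tau ^ 4 * edge3 z"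
  "edge3 (branch 2 z) = tau + tau * edge1 z + tau ^ 2 * edge4 z"
  "edge4 (branch 2 z) = tau ^ 3 * edge3 z"
  "edge1 (branch 3 z) = tau ^ 3 + tau ^ 3 * edge2 z + tau ^ 4 * edge3 z"
  "edge2 (branch 3 z) = tau ^ 2 * edge1 z + tau ^ 3 * edge4 z"
  "edge3 (branch 3 z) = tau * edge4 z"
  "edge4 (branch 3 z) = tau ^ 2 + tau ^ 2 * edge1 z + tau ^ 4 * edge3 z"
  "edge1 (branch 5 z) = tau ^ 2 * edge1 z"
  "edge2 (branch 5 z) = tau ^ 2 + tau ^ 2 * edge2 z"
  "edge3 (branch 5 z) = 1 + tau ^ 2 * edge3 z"
  "edge4 (branch 5 z) = tau ^ 2 * edge4 z"
  unfolding edge_defs branch_coords tau_powers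
  by (simp_all add: algebra_simps tau_sq)

lemma trapezoid_invariant:
  assumes "z \<in> trapezoid" "m \<in> digits"
  shows "branch m z \<in> trapezoid"
  using assms tau_pos unfolding trapezoid_def by (auto simp: edge_branch)

text \<open>Images of branches 0 and 3, of 2 and 3, and of 2 and 5, respectively, touch in these points.\<close>
abbreviation contact_points :: "complex set" where
  "contact_points \<equiv>
     {of_real (tau ^ 2) * zeta, of_real tau * zeta, zeta + of_real (tau ^ 2) * zeta ^ 3}"

text \<open>For each pair of branches one of the four edge functionals takes, on the image of one of them,
  values at least as large as on the image of the other. For three pairs the separation is strict;
  for the other three, equality forces the preimage in one of the two trapezoids to be a vertex.\<close>
lemma branch_overlap_less:
  assumes K: "x \<in> trapezoid" "y \<in> trapezoid"
    and ab: "a \<in> digits" "b \<in> digits" "a < b" and eq: "branch a x = branch b y"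
  shows "branch a x \<in> contact_points"
proof -
  have nonneg: "0 \<le> edge1 x" "0 \<le> edge2 x" "0 \<le> edge3 x" "0 \<le> edge4 x"
    "0 \<le> edge1 y" "0 \<le> edge2 y" "0 \<le> edge3 y" "0 \<le> edge4 y"
    using K by (auto simp: trapezoid_def)
  have zeroI: "u = 0 \<and> v = 0" if "c * u + c' * v \<le> 0" "0 < c" "0 < c'" "0 \<le> u" "0 \<le> v" for c c' u v :: real
    using that by (smt (verit, ccfv_threshold) mult_nonneg_nonneg mult_pos_pos)
  note scaled = mult_nonneg_nonneg[OF zero_le_power[OF less_imp_le[OF tau_pos(1)]]]
    mult_nonneg_nonneg[OF less_imp_le[OF tau_pos(1)]]
  from ab consider "a = 0" "b = 2" | "a = 0" "b = 3" | "a = 0" "b = 5" | "a = 2" "b = 3"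
    | "a = 2" "b = 5" | "a = 3" "b = 5" by auto
  then show ?thesis
  proof cases
    case 1
    \<comment> \<open>On \<open>edge4\<close>: at least \<open>tau\<close> against at most \<open>tau\<^sup>2\<close>.\<close>
    have "tau ^ 3 * edge3 y = tau ^ 2 - tau ^ 2 * edge4 y - tau ^ 3 * edge1 y"
      unfolding edge_relation by (simp add: eval_nat_numeral algebra_simps)
    moreover have "tau + tau ^ 2 * edge4 x = tau ^ 3 * edge3 y"
      using arg_cong[OF eq, of edge4] unfolding 1 edge_branch .
    ultimately have False
      using scaled(1)[OF nonneg(4), of 2] scaled(1)[OF nonneg(8), of 2]
        scaled(1)[OF nonneg(5), of 3] tau_bounds tau_powers by linarith
    then show ?thesis ..
  next
    case 2
    \<comment> \<open>On \<open>edge1\<close>, with \<open>tau\<^sup>3\<close> as common value; \<open>y\<close> must be the vertex \<open>tau\<^sup>2 * (1 + zeta)\<close>.\<close>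
    have "tau ^ 2 * edge1 x = tau ^ 3 + tau ^ 3 * edge2 y + tau ^ 4 * edge3 y"
      using arg_cong[OF eq, of edge1] unfolding 2 edge_branch .
    moreover have "tau ^ 2 * edge1 x = tau ^ 3 - tau ^ 2 * edge2 x"
      by (simp add: edge2_def eval_nat_numeral algebra_simps)
    ultimately have "tau ^ 3 * edge2 y + tau ^ 4 * edge3 y \<le> 0"
      using scaled(1)[OF nonneg(2), of 2] by linarith
    then have y: "edge2 y = 0" "edge3 y = 0"
      using zeroI nonneg tau_pos by (metis zero_less_power)+
    then have y1: "edge1 y = tau" by (simp add: edge2_def)
    then have "branch 3 y = of_real (tau ^ 2) * zeta"
      by (intro edge_eqI)
        (simp_all only: edge_branch edge_relation[of y] y y1,
          simp_all only: edge3_def edge4_def coord_scale coord_zeta,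
          simp_all add: tau_powers algebra_simps tau_sq)
    then show ?thesis using eq 2 by simp
  next
    case 3
    \<comment> \<open>On \<open>edge4\<close>: at least \<open>tau\<close> against at most \<open>tau\<^sup>2\<close>.\<close>
    have "edge4 y \<le> 1" using edge_relation[of y] scaled(2)[OF nonneg(5)] scaled(2)[OF nonneg(7)] by linarith
    then have "tau ^ 2 * edge4 y \<le> tau ^ 2 * 1" using tau_pos by (intro mult_left_mono) auto
    moreover have "tau + tau ^ 2 * edge4 x = tau ^ 2 * edge4 y"
      using arg_cong[OF eq, of edge4] unfolding 3 edge_branch .
    ultimately have False
      using scaled(1)[OF nonneg(4), of 2] tau_bounds tau_powers by linarith
    then show ?thesis ..
  next
    case 4
    \<comment> \<open>On \<open>edge3\<close>, with \<open>tau\<close> as common value; \<open>y\<close> must be the vertex \<open>0\<close>.\<close>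
    have "tau + tau * edge1 x + tau ^ 2 * edge4 x = tau * edge4 y"
      using arg_cong[OF eq, of edge3] unfolding 4 edge_branch .
    moreover have "tau * edge4 y = tau - (tau ^ 2 * edge1 y + tau ^ 2 * edge3 y)"
      unfolding edge_relation by (simp add: eval_nat_numeral algebra_simps)
    ultimately have "tau ^ 2 * edge1 y + tau ^ 2 * edge3 y \<le> 0"
      using scaled(1)[OF nonneg(4), of 2] scaled(2)[OF nonneg(1)] by linarith
    then have y: "edge1 y = 0" "edge3 y = 0"
      using zeroI nonneg tau_pos by (metis zero_less_power)+
    then have "branch 3 y = of_real tau * zeta"
      by (intro edge_eqI)
        (simp_all only: edge_branch edge_relation[of y] y,
          simp_all only: edge3_def edge4_def coord_scale coord_zeta,
          simp_all add: tau_powers algebra_simps tau_sq)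
    then show ?thesis using eq 4 by simp
  next
    case 5
    \<comment> \<open>On \<open>edge1\<close>, with \<open>tau\<^sup>3\<close> as common value; \<open>x\<close> must be the vertex \<open>zeta\<close>.\<close>
    have "tau ^ 3 + tau ^ 3 * edge2 x + tau ^ 3 * edge4 x = tau ^ 2 * edge1 y"
      using arg_cong[OF eq, of edge1] unfolding 5 edge_branch .
    moreover have "tau ^ 2 * edge1 y = tau ^ 3 - tau ^ 2 * edge2 y"
      by (simp add: edge2_def eval_nat_numeral algebra_simps)
    ultimately have "tau ^ 3 * edge2 x + tau ^ 3 * edge4 x \<le> 0"
      using scaled(1)[OF nonneg(6), of 2] by linarith
    then have x: "edge2 x = 0" "edge4 x = 0"
      using zeroI nonneg tau_pos by (metis zero_less_power)+
    have x1: "edge1 x = tau" using x(1) by (simp add: edge2_def)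
    have "tau * (edge3 x - 1) = 0"
      using edge_relation[of x] x1 x(2) by (simp add: algebra_simps tau_sq)
    then have x3: "edge3 x = 1" using tau_pos by simp
    have "branch 2 x = zeta + of_real (tau ^ 2) * zeta ^ 3"
    proof (rule edge_eqI)
      have c: "s_of (zeta + of_real (tau ^ 2) * zeta ^ 3) = 1 - 2 * tau"
        "t_of (zeta + of_real (tau ^ 2) * zeta ^ 3) = 2 - 2 * tau"
        unfolding coord_add coord_scale power3_eq_cube mult.assoc coord_zeta
        by (simp_all add: tau_powers algebra_simps tau_sq)
      show "edge3 (branch 2 x) = edge3 (zeta + of_real (tau ^ 2) * zeta ^ 3)"
        "edge4 (branch 2 x) = edge4 (zeta + of_real (tau ^ 2) * zeta ^ 3)"
        unfolding edge_branch x x1 x3 by (simp_all only: edge3_def edge4_def c) (simp_all add: tau_powers tau_sq)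
    qed
    then show ?thesis using 5 by simp
  next
    case 6
    \<comment> \<open>On \<open>edge3\<close>: at most \<open>tau\<close> against at least 1.\<close>
    have "edge4 x \<le> 1" using edge_relation[of x] scaled(2)[OF nonneg(1)] scaled(2)[OF nonneg(3)] by linarith
    then have "tau * edge4 x \<le> tau * 1" using tau_pos by (intro mult_left_mono) auto
    moreover have "tau * edge4 x = 1 + tau ^ 2 * edge3 y"
      using arg_cong[OF eq, of edge3] unfolding 6 edge_branch .
    ultimately have False
      using scaled(1)[OF nonneg(7), of 2] tau_bounds by linarith
    then show ?thesis ..
  qed
qed

lemma branch_overlap:
  assumes "x \<in> trapezoid" "y \<in> trapezoid"
    and "a \<in> digits" "b \<in> digits" "a \<noteq> b" and "branch a x = branch b y"
  shows "branch a x \<in> contact_points"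
  using branch_overlap_less[of x y a b] branch_overlap_less[of y x b a] assms by (cases "a < b") auto

section \<open>The Galois automorphism and the conjugate maps\<close>

lemma Gal_hom:
  assumes "\<phi> \<in> Gal Q_zeta \<rat>"
  shows "x \<in> Q_zeta \<Longrightarrow> y \<in> Q_zeta \<Longrightarrow> \<phi> (x + y) = \<phi> x + \<phi> y"
    and "x \<in> Q_zeta \<Longrightarrow> y \<in> Q_zeta \<Longrightarrow> \<phi> (x * y) = \<phi> x * \<phi> y"
    and "x \<in> \<rat> \<Longrightarrow> \<phi> x = x"
  using assms by (auto simp: Gal_def ring_iso_def ring_hom_def ring_of_type_algebra_def)

lemma Gal_power:
  assumes "\<phi> \<in> Gal Q_zeta \<rat>" "x \<in> Q_zeta"
  shows "\<phi> (x ^ n) = \<phi> x ^ n"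
  using assms by (induction n) (simp_all add: Gal_hom Q_zeta_power)

lemma Gal_conj_pair:
  assumes phi: "\<phi> \<in> Gal Q_zeta \<rat>" "\<phi> zeta = zeta\<^sup>2" and "conj_pair x x'"
  shows "x \<in> Q_zeta" "\<phi> x = x'"
proof -
  obtain a b c e where x: "x = cyc a b c e zeta" "x' = cyc a b c e (zeta\<^sup>2)"
    using assms unfolding conj_pair_def by blast
  show "x \<in> Q_zeta" unfolding x cyc_def
    by (intro Q_zeta_add Q_zeta_mult Q_zeta_of_int Q_zeta_power Q_zeta_zeta)
  show "\<phi> x = x'" unfolding x cyc_def
    by (simp add: Gal_hom[OF phi(1)] Gal_power[OF phi(1)] phi(2)
        Q_zeta_add Q_zeta_mult Q_zeta_of_int Q_zeta_power Q_zeta_zeta)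
qed

text \<open>Conjugate pairs with the common denominator \<open>N\<close>.\<close>
definition frac_pair :: "int \<Rightarrow> complex \<Rightarrow> complex \<Rightarrow> bool" where
  "frac_pair N x x' \<longleftrightarrow> conj_pair (of_int N * x) (of_int N * x')"

lemma Gal_frac_pair:
  assumes phi: "\<phi> \<in> Gal Q_zeta \<rat>" "\<phi> zeta = zeta\<^sup>2"
    and "frac_pair N x x'" "N \<noteq> 0"
  shows "x \<in> Q_zeta" "\<phi> x = x'"
proof -
  have N: "of_int N * x \<in> Q_zeta" "\<phi> (of_int N * x) = of_int N * x'"
    using assms Gal_conj_pair[OF phi] by (auto simp: frac_pair_def)
  have "of_rat (1 / of_int N) * (of_int N * x) \<in> Q_zeta"
    by (intro Q_zeta_mult N Q_zeta_Rats Rats_of_rat)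
  also have "of_rat (1 / of_int N) * (of_int N * x) = x"
    using assms(4) by (simp add: of_rat_divide)
  finally show x: "x \<in> Q_zeta" .
  have "of_int N * \<phi> x = of_int N * x'"
    using N(2) Gal_hom(2,3)[OF phi(1)] x Q_zeta_of_int by simp
  then show "\<phi> x = x'" using assms(4) by simp
qed

lemma Q_zeta_frac_pair:
  assumes phi: "\<phi> \<in> Gal Q_zeta \<rat>" "\<phi> zeta = zeta\<^sup>2" and x: "x \<in> Q_zeta"
  obtains N where "N \<noteq> 0" "frac_pair N x (\<phi> x)"
proof -
  obtain N a b c e where N: "N \<noteq> 0" "of_int N * x = cyc a b c e zeta"
    using Q_zeta_denominator[OF x] by metis
  have "conj_pair (of_int N * x) (cyc a b c e (zeta\<^sup>2))" using N(2) unfolding conj_pair_def by blast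
  moreover have "\<phi> (of_int N * x) = of_int N * \<phi> x"
    using Gal_hom(2,3)[OF phi(1)] x Q_zeta_of_int by simp
  ultimately have "frac_pair N x (\<phi> x)" using Gal_conj_pair[OF phi] unfolding frac_pair_def by metis
  then show thesis using that N by blast
qed

lemma zeta_sq_power_4: "(zeta\<^sup>2) ^ 4 = zeta ^ 3"
proof -
  have "(zeta\<^sup>2) ^ 4 = zeta ^ 5 * zeta ^ 3" by (simp flip: power_add power_mult)
  then show ?thesis by (simp add: zeta_5)
qed

lemma conj_pair_tau: "conj_pair (of_real tau) (of_real (- 1 - tau))"
proof -
  have e: "of_real (- 1 - tau) = zeta\<^sup>2 + (zeta\<^sup>2) ^ 4"
    unfolding zeta_sq_power_4 by (simp add: tau_zeta zeta_cyclotomic)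
  show ?thesis unfolding e unfolding tau_zeta
    by (intro conj_pair_add conj_pair_power conj_pair_zeta)
qed

definition conj_digit :: "nat \<Rightarrow> complex" where
  "conj_digit m = (if m = 2 then zeta\<^sup>2
                else if m = 3 then of_real (- 1 - tau) * zeta\<^sup>2
                else if m = 5 then of_real (1 + tau) * zeta ^ 3
                else 0)"

lemma conj_pair_digit: "conj_pair (d m) (conj_digit m)"
proof -
  have inv: "inverse zeta = zeta ^ 4"
    by (rule inverse_unique) (use zeta_5 in \<open>simp add: eval_nat_numeral mult.assoc\<close>)
  have "d 5 = - (1 / omega * inverse zeta)" by (simp add: d_def divide_inverse)
  then have "d 5 = - (of_real tau * zeta ^ 4)" by (simp only: inv inverse_omega)
  moreover have "conj_digit 5 = - (of_real (- 1 - tau) * (zeta\<^sup>2) ^ 4)"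
    unfolding zeta_sq_power_4 by (simp add: conj_digit_def algebra_simps)
  ultimately have "conj_pair (d 5) (conj_digit 5)"
    by (simp only:) (intro conj_pair_uminus conj_pair_mult conj_pair_tau conj_pair_power conj_pair_zeta)
  moreover have "conj_pair (d 3) (conj_digit 3)"
    using conj_pair_mult[OF conj_pair_tau conj_pair_zeta] by (simp add: d_values conj_digit_def)
  moreover have "conj_pair (d 2) (conj_digit 2)"
    using conj_pair_zeta by (simp add: d_values conj_digit_def)
  moreover have "conj_pair (d m) (conj_digit m)" if "m \<notin> {2, 3, 5}"
    using conj_pair_of_int[of 0] that by (simp add: d_def conj_digit_def)
  ultimately show ?thesis by blast
qed

text \<open>The expansion conjugate to \<^const>\<open>branch\<close>, with \<open>- 1 - tau = - \<omega>\<close> as the conjugate of \<open>tau\<close>.\<close>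
definition conj_branch :: "nat \<Rightarrow> complex \<Rightarrow> complex" where
  "conj_branch m z = of_real (- 1 - tau) ^ 2 * (zeta\<^sup>2) ^ m * z + conj_digit m"

lemma frac_pair_branch: "frac_pair N x x' \<Longrightarrow> frac_pair N (branch m x) (conj_branch m x')"
proof -
  assume "frac_pair N x x'"
  then have x: "conj_pair (of_int N * x) (of_int N * x')" by (simp only: frac_pair_def)
  have "conj_pair (of_real tau ^ 2 * zeta ^ m) (of_real (- 1 - tau) ^ 2 * (zeta\<^sup>2) ^ m)"
    by (intro conj_pair_mult conj_pair_power conj_pair_tau conj_pair_zeta)
  from conj_pair_add[OF conj_pair_mult[OF this x] conj_pair_mult[OF conj_pair_of_int conj_pair_digit]]
  have "conj_pair (of_real tau ^ 2 * zeta ^ m * (of_int N * x) + of_int N * d m)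
    (of_real (- 1 - tau) ^ 2 * (zeta\<^sup>2) ^ m * (of_int N * x') + of_int N * conj_digit m)" .
  moreover have "of_real tau ^ 2 * zeta ^ m * (of_int N * x) + of_int N * d m = of_int N * branch m x"
    by (simp add: branch_def algebra_simps)
  moreover have "of_real (- 1 - tau) ^ 2 * (zeta\<^sup>2) ^ m * (of_int N * x') + of_int N * conj_digit m
      = of_int N * conj_branch m x'"
    unfolding conj_branch_def distrib_left by (simp only: ac_simps)
  ultimately show ?thesis by (simp only: frac_pair_def)
qed

text \<open>The exponent \<open>3 * m\<close> inverts the factor \<open>(zeta\<^sup>2) ^ m\<close> of \<^const>\<open>conj_branch\<close>, as
  \<open>zeta ^ (5 * m) = 1\<close>; for the four digits it gives the factors \<open>1\<close>, \<open>zeta\<close>, \<open>inverse zeta\<close>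
  and \<open>1\<close>.\<close>
definition dual_branch :: "nat \<Rightarrow> complex \<Rightarrow> complex" where
  "dual_branch m z = of_real (tau\<^sup>2) * zeta ^ (3 * m) * (z - conj_digit m)"

lemma dual_branch_conj: "dual_branch m (conj_branch m z) = z"
proof -
  have "dual_branch m (conj_branch m z) = of_real ((tau * (1 + tau))\<^sup>2) * (zeta ^ (3 * m) * (zeta\<^sup>2) ^ m) * z"
    by (simp add: dual_branch_def conj_branch_def power_mult_distrib) (simp add: power2_eq_square algebra_simps)
  also have "zeta ^ (3 * m) * (zeta\<^sup>2) ^ m = (zeta ^ 5) ^ m"
    by (simp flip: power_mult power_add add: algebra_simps)
  also have "tau * (1 + tau) = 1" by (simp add: algebra_simps tau_sq)
  finally show ?thesis by (simp add: zeta_5)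
qed

lemma conj_branch_dual: "conj_branch m (dual_branch m z) = z"
proof -
  have "dual_branch m (conj_branch m (dual_branch m z)) = dual_branch m z" by (rule dual_branch_conj)
  moreover have "tau \<noteq> 0" using tau_pos by simp
  ultimately show ?thesis by (simp add: dual_branch_def)
qed

section \<open>The attractor and its dual\<close>

lemma branch_dist: "dist (branch m x) (branch m y) = tau\<^sup>2 * dist x y"
proof -
  have "branch m x - branch m y = of_real (tau\<^sup>2) * zeta ^ m * (x - y)"
    by (simp add: branch_def algebra_simps)
  then show ?thesis by (simp add: dist_norm norm_mult norm_power)
qed

lemma dual_branch_dist: "dist (dual_branch m x) (dual_branch m y) = tau\<^sup>2 * dist x y"
proof -
  have "dual_branch m x - dual_branch m y = of_real (tau\<^sup>2) * zeta ^ (3 * m) * (x - y)"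
    by (simp add: dual_branch_def algebra_simps)
  then show ?thesis by (simp add: dist_norm norm_mult norm_power)
qed

lemma contraction_ratio: "0 \<le> tau\<^sup>2" "tau\<^sup>2 < 1"
  using tau_pos by (simp_all add: tau_powers)

lemma inverse_omega_sq: "1 / omega\<^sup>2 = of_real (tau\<^sup>2)"
  by (metis inverse_omega of_real_power power_one_over)

lemma Y'_eq: "Y' = attractor (\<lambda>Y. \<Union>m\<in>digits. branch m ` Y)"
proof -
  have "zeta ^ m / omega\<^sup>2 * z + d m = branch m z" for m z
    unfolding branch_def inverse_omega_sq[symmetric] by simp
  then show ?thesis by (simp only: Y'_def)
qed

lemma Y'_properties: "Y' \<noteq> {}" "compact Y'" "Y' = (\<Union>m\<in>digits. branch m ` Y')"
proof -
  note * = attractor_properties[of digits branch "tau\<^sup>2", folded Y'_eq]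
  show "Y' \<noteq> {}" "compact Y'" "Y' = (\<Union>m\<in>digits. branch m ` Y')"
    by (rule *; simp add: branch_dist contraction_ratio)+
qed

lemma dual_attractor_eq:
  assumes "\<And>m. \<phi> (d m) = conj_digit m"
  shows "dual_attractor \<phi> = attractor (\<lambda>Y. \<Union>m\<in>digits. dual_branch m ` Y)"
proof -
  have p: "zeta ^ (3 * 2) = zeta" "zeta ^ (3 * 5) = 1"
    using zeta_5 power_mult[of zeta 5 3] power_add[of zeta 5 1] by simp_all
  have "inverse zeta = zeta ^ 9"
    using zeta_5 power_add[of zeta 5 4] power_add[of zeta 1 4] by (intro inverse_unique) simp
  then have p3: "zeta ^ (3 * 3) = inverse zeta" by simp
  have "1 / omega\<^sup>2 * (z - conj_digit 0) = dual_branch 0 z"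
    "zeta / omega\<^sup>2 * (z - conj_digit 2) = dual_branch 2 z"
    "inverse zeta / omega\<^sup>2 * (z - conj_digit 3) = dual_branch 3 z"
    "1 / omega\<^sup>2 * (z - conj_digit 5) = dual_branch 5 z" for z
    unfolding dual_branch_def p p3 inverse_omega_sq[symmetric] by simp_all
  then show ?thesis by (simp add: dual_attractor_def assms Un_assoc)
qed

lemma dual_attractor_properties:
  assumes "\<And>m. \<phi> (d m) = conj_digit m"
  shows "dual_attractor \<phi> \<noteq> {}" "compact (dual_attractor \<phi>)"
    "dual_attractor \<phi> = (\<Union>m\<in>digits. dual_branch m ` dual_attractor \<phi>)"
proof -
  note * = attractor_properties[of digits dual_branch "tau\<^sup>2",
      folded dual_attractor_eq[OF assms]]
  show "dual_attractor \<phi> \<noteq> {}" "compact (dual_attractor \<phi>)"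
    "dual_attractor \<phi> = (\<Union>m\<in>digits. dual_branch m ` dual_attractor \<phi>)"
    by (rule *; simp add: dual_branch_dist contraction_ratio)+
qed

lemma Y'_subset_trapezoid: "Y' \<subseteq> trapezoid"
proof (rule attractor_compare[where I = digits and f = branch and r = "tau\<^sup>2"])
  have "0 \<in> trapezoid" using tau_pos by (simp add: trapezoid_def edge_defs)
  then show "trapezoid \<noteq> {}" by blast
  show "bounded Y'" "Y' \<subseteq> (\<Union>m\<in>digits. branch m ` Y')"
    using Y'_properties compact_imp_bounded by blast+
  show "(\<Union>m\<in>digits. branch m ` trapezoid) \<subseteq> trapezoid"
    using trapezoid_invariant by blast
qed (simp_all add: branch_dist contraction_ratio closed_trapezoid)

lemma norm_dual_digit: "norm (conj_digit m) \<le> 1 + tau"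
proof -
  have "norm (of_real (- 1 - tau) :: complex) = 1 + tau" "norm (of_real (1 + tau) :: complex) = 1 + tau"
    using tau_pos by (simp_all only: norm_of_real)
  then show ?thesis
    using tau_pos by (simp add: conj_digit_def norm_mult norm_power del: of_real_diff of_real_add)
qed

text \<open>The digits have modulus at most \<open>1 + tau\<close>, and \<open>tau\<^sup>2 * (1 + (1 + tau)) = 1\<close>: so every
  dual branch maps the closed unit disc into itself.\<close>
lemma dual_attractor_bounded:
  assumes "\<And>m. \<phi> (d m) = conj_digit m"
  shows "dual_attractor \<phi> \<subseteq> cball 0 1"
proof (rule attractor_compare[where I = digits and f = dual_branch and r = "tau\<^sup>2"])
  show "bounded (dual_attractor \<phi>)"
    "dual_attractor \<phi> \<subseteq> (\<Union>m\<in>digits. dual_branch m ` dual_attractor \<phi>)"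
    using dual_attractor_properties[OF assms] compact_imp_bounded by blast+
  have "norm (dual_branch m z) \<le> 1" if "norm z \<le> 1" for m z
  proof -
    have "norm (z - conj_digit m) \<le> 1 + (1 + tau)"
      using norm_triangle_ineq4[of z "conj_digit m"] that norm_dual_digit[of m] by linarith
    then have "tau\<^sup>2 * norm (z - conj_digit m) \<le> tau\<^sup>2 * (1 + (1 + tau))"
      by (intro mult_left_mono) auto
    also have "\<dots> = 1" by (simp add: tau_powers algebra_simps tau_sq)
    finally show ?thesis by (simp add: dual_branch_def norm_mult norm_power)
  qed
  then show "(\<Union>m\<in>digits. dual_branch m ` cball 0 1) \<subseteq> cball 0 1" by auto
qed (simp_all add: dual_branch_dist contraction_ratio)

section \<open>Finitely many points with bounded conjugates\<close>

text \<open>Applied to \<open>zeta\<close> with \<open>k = tau\<close> and to \<open>zeta\<^sup>2\<close> with \<open>k = - 1 - tau\<close>, the two roots of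
  \<open>k\<^sup>2 = 1 - k\<close>.\<close>
lemma cyc_coords:
  assumes w: "Im w \<noteq> 0" "w\<^sup>2 = of_real k * w - 1" and k: "k * k = 1 - k"
  shows "coord_one w (cyc a b c e w) = of_int a - of_int c - k * of_int e"
    "coord_dir w (cyc a b c e w) = of_int b + k * (of_int c - of_int e)"
proof -
  have e: "cyc a b c e w = of_real (of_int a) + of_real (of_int b) * w
      + of_real (of_int c) * (w * w) + of_real (of_int e) * (w * (w * w))"
    by (simp add: cyc_def power2_eq_square power3_eq_cube)
  have k3: "k * (k * x) = x - k * x" for x
  proof -
    have "k * (k * x) = k * k * x" by simp
    then show ?thesis by (simp only: k) (simp add: algebra_simps)
  qed
  show "coord_one w (cyc a b c e w) = of_int a - of_int c - k * of_int e"
    "coord_dir w (cyc a b c e w) = of_int b + k * (of_int c - of_int e)"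
    unfolding e coord_add coord_scale coord_rotate[OF w] coord_base[OF w(1)] coord_of_real
    by (simp_all add: algebra_simps k3 k)
qed

lemma coord_bound:
  assumes "norm z \<le> B"
  shows "\<bar>coord_dir w z\<bar> \<le> B / \<bar>Im w\<bar>" "\<bar>coord_one w z\<bar> \<le> B + B / \<bar>Im w\<bar> * \<bar>Re w\<bar>"
proof -
  show t: "\<bar>coord_dir w z\<bar> \<le> B / \<bar>Im w\<bar>"
    using assms abs_Im_le_cmod[of z] by (auto simp: coord_dir_def intro: divide_right_mono)
  have "\<bar>coord_one w z\<bar> \<le> \<bar>Re z\<bar> + \<bar>coord_dir w z\<bar> * \<bar>Re w\<bar>"
    unfolding coord_one_def by (metis abs_mult abs_triangle_ineq4)
  then show "\<bar>coord_one w z\<bar> \<le> B + B / \<bar>Im w\<bar> * \<bar>Re w\<bar>"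
    using assms abs_Re_le_cmod[of z] mult_right_mono[OF t, of "\<bar>Re w\<bar>"] by linarith
qed

lemma Im_zeta2: "Im (zeta\<^sup>2) > 0"
proof -
  have "Im (zeta\<^sup>2) = tau * Im zeta" unfolding zeta_sq by simp
  then show ?thesis using tau_pos Im_zeta by simp
qed

lemma conj_zeta_sq: "(zeta\<^sup>2)\<^sup>2 = of_real (- 1 - tau) * zeta\<^sup>2 - 1"
proof -
  have "of_real (- 1 - tau) * zeta\<^sup>2 = (zeta\<^sup>2 + zeta ^ 3) * zeta\<^sup>2"
    by (simp add: tau_zeta zeta_cyclotomic)
  also have "\<dots> = (zeta\<^sup>2)\<^sup>2 + zeta ^ 5"
    by (simp add: eval_nat_numeral algebra_simps)
  finally show ?thesis by (simp add: zeta_5)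
qed

text \<open>Comparing the coordinates of \<open>x\<close> and \<open>x'\<close> isolates the integer coefficients: up to sign they
  differ by \<open>sqrt 5 = 1 + 2 * tau\<close> times \<open>e\<close> and \<open>c - e\<close>, so these are bounded, and then so are \<open>b\<close> and
  \<open>a\<close>.\<close>
lemma finite_frac_pairs:
  assumes "N \<noteq> 0"
  shows "finite {x. \<exists>x'. frac_pair N x x' \<and> norm x \<le> B \<and> norm x' \<le> B}"
proof -
  define M where "M = \<bar>of_int N\<bar> * B"
  define T where "T = M / \<bar>Im zeta\<bar> + M / \<bar>Im (zeta\<^sup>2)\<bar>"
  define S where "S = (M + M / \<bar>Im zeta\<bar> * \<bar>Re zeta\<bar>)
    + (M + M / \<bar>Im (zeta\<^sup>2)\<bar> * \<bar>Re (zeta\<^sup>2)\<bar>)"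
  define C where "C = \<lceil>2 * \<bar>S\<bar> + 2 * \<bar>T\<bar>\<rceil>"
  let ?R = "{- 4 * C..4 * C} :: int set"
  have "{x. \<exists>x'. frac_pair N x x' \<and> norm x \<le> B \<and> norm x' \<le> B}
    \<subseteq> (\<lambda>(a, b, c, e). cyc a b c e zeta / of_int N) ` (?R \<times> ?R \<times> ?R \<times> ?R)"
  proof clarify
    fix x x' assume "frac_pair N x x'" and B: "norm x \<le> B" "norm x' \<le> B"
    then obtain a b c e where x: "of_int N * x = cyc a b c e zeta" "of_int N * x' = cyc a b c e (zeta\<^sup>2)"
      unfolding frac_pair_def conj_pair_def by blast
    have M: "norm (cyc a b c e zeta) \<le> M" "norm (cyc a b c e (zeta\<^sup>2)) \<le> M"
      unfolding x[symmetric] M_def by (simp_all add: norm_mult B mult_left_mono)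
    have k: "(- 1 - tau) * (- 1 - tau) = 1 - (- 1 - tau)" by (simp add: algebra_simps tau_sq)
    note c1 = cyc_coords[OF less_imp_neq[OF Im_zeta, symmetric] zeta_sq tau_sq]
    note c2 = cyc_coords[OF less_imp_neq[OF Im_zeta2, symmetric] conj_zeta_sq k]
    define s t s' t' :: real where "s = of_int a - of_int c - tau * of_int e"
      and "t = of_int b + tau * (of_int c - of_int e)"
      and "s' = of_int a - of_int c - (- 1 - tau) * of_int e"
      and "t' = of_int b + (- 1 - tau) * (of_int c - of_int e)"
    note defs = s_def t_def s'_def t'_def
    have st: "\<bar>s\<bar> + \<bar>s'\<bar> \<le> S" "\<bar>t\<bar> + \<bar>t'\<bar> \<le> T"
      using coord_bound[OF M(1), of zeta] coord_bound[OF M(2), of "zeta\<^sup>2"]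
      unfolding S_def T_def c1 c2 defs by (intro add_mono; simp only:)+
    have grow: "\<bar>h\<bar> \<le> \<bar>h + 2 * (tau * h)\<bar>" "\<bar>tau * h\<bar> \<le> \<bar>h\<bar>" for h
    proof -
      have "h + 2 * (tau * h) = (1 + 2 * tau) * h" by (simp add: algebra_simps)
      moreover have "\<bar>1 + 2 * tau\<bar> = 1 + 2 * tau" using tau_pos by simp
      ultimately have "\<bar>h + 2 * (tau * h)\<bar> = (1 + 2 * tau) * \<bar>h\<bar>" by (simp only: abs_mult)
      also have "\<dots> \<ge> 1 * \<bar>h\<bar>" using tau_pos by (intro mult_right_mono) auto
      finally show "\<bar>h\<bar> \<le> \<bar>h + 2 * (tau * h)\<bar>" by simp
      have "tau * \<bar>h\<bar> \<le> 1 * \<bar>h\<bar>" using tau_pos by (intro mult_right_mono) auto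
      then show "\<bar>tau * h\<bar> \<le> \<bar>h\<bar>" using tau_pos by (simp add: abs_mult)
    qed
    have "s' - s = of_int e + 2 * (tau * of_int e)" by (simp add: defs algebra_simps)
    then have e: "\<bar>of_int e\<bar> \<le> S"
      using st(1) grow(1)[of "of_int e"] abs_triangle_ineq4[of s' s] by simp
    have "t - t' = (of_int c - of_int e) + 2 * (tau * (of_int c - of_int e))"
      by (simp add: defs algebra_simps)
    then have ce: "\<bar>of_int c - of_int e\<bar> \<le> T"
      using st(2) grow(1)[of "of_int c - of_int e"] abs_triangle_ineq4[of t t'] by simp
    have "of_int b = t - tau * (of_int c - of_int e)" by (simp add: defs)
    then have b: "\<bar>of_int b\<bar> \<le> 2 * T"
      using st(2) ce grow(2)[of "of_int c - of_int e"]
        abs_triangle_ineq4[of t "tau * (of_int c - of_int e)"] abs_ge_zero[of t'] by simp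
    have "of_int a - of_int c = s + tau * of_int e" by (simp add: defs)
    then have ac: "\<bar>of_int a - of_int c\<bar> \<le> 2 * S"
      using st(1) e grow(2)[of "of_int e"] abs_triangle_ineq[of s "tau * of_int e"]
        abs_ge_zero[of s'] by simp
    have "2 * \<bar>S\<bar> + 2 * \<bar>T\<bar> \<le> of_int C" unfolding C_def by (rule le_of_int_ceiling)
    moreover have S0: "0 \<le> S" using e abs_ge_zero by (rule order_trans[rotated])
    moreover have T0: "0 \<le> T" using ce abs_ge_zero by (rule order_trans[rotated])
    ultimately have C: "2 * S + 2 * T \<le> of_int C" by simp
    have c: "\<bar>of_int c\<bar> \<le> T + S"
      using abs_triangle_ineq[of "of_int c - of_int e" "of_int e :: real"] ce e by simp
    have a: "\<bar>of_int a\<bar> \<le> 2 * S + (T + S)"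
      using abs_triangle_ineq[of "of_int a - of_int c" "of_int c :: real"] ac c by simp
    have "\<bar>of_int a :: real\<bar> \<le> of_int (4 * C)" using a C S0 T0 by simp
    moreover have "\<bar>of_int b :: real\<bar> \<le> of_int (4 * C)" using b C S0 T0 by simp
    moreover have "\<bar>of_int c :: real\<bar> \<le> of_int (4 * C)" using c C S0 T0 by simp
    moreover have "\<bar>of_int e :: real\<bar> \<le> of_int (4 * C)" using e C S0 T0 by simp
    ultimately have "\<bar>a\<bar> \<le> 4 * C" "\<bar>b\<bar> \<le> 4 * C" "\<bar>c\<bar> \<le> 4 * C" "\<bar>e\<bar> \<le> 4 * C"
      unfolding of_int_abs[symmetric] of_int_le_iff by blast+
    then have "a \<in> ?R" "b \<in> ?R" "c \<in> ?R" "e \<in> ?R"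
      by (auto simp: abs_le_iff)
    moreover have "x = cyc a b c e zeta / of_int N" 
      unfolding x(1)[symmetric] using assms by simp
    ultimately show "x \<in> (\<lambda>(a, b, c, e). cyc a b c e zeta / of_int N) ` (?R \<times> ?R \<times> ?R \<times> ?R)"
      by (intro image_eqI[of _ _ "(a, b, c, e)"]) (simp_all only: prod.case mem_Times_iff fst_conv snd_conv simp_thms)
  qed
  then show ?thesis by (rule finite_subset) auto
qed

section \<open>Codings as backward orbits\<close>

lemma nested_Suc: "nested (Suc n) k = branch (xi (k 0)) (nested n (\<lambda>i. k (Suc i)))"
  unfolding branch_def inverse_omega_sq[symmetric] by simp

lemma xi_values: "xi 0 = 0" "xi 1 = 2" "xi 2 = 3" "xi 3 = 5"
  by (simp_all add: xi_def)

lemma xi_in_digits: "k \<in> {0, 1, 2, 3} \<Longrightarrow> xi k \<in> digits"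
  using xi_values by blast

lemma digit_from_xi: "m \<in> digits \<Longrightarrow> \<exists>k. k \<in> {0, 1, 2, 3} \<and> xi k = m"
  using xi_values by blast

lemma coding_tail:
  assumes "is_mult_coding k y"
  shows "\<exists>y'. is_mult_coding (\<lambda>i. k (Suc i)) y' \<and> y = branch (xi (k 0)) y'"
proof -
  define c where "c = of_real (tau\<^sup>2) * zeta ^ xi (k 0)"
  have c: "c \<noteq> 0" using tau_pos by (simp add: c_def)
  have inv: "branch (xi (k 0)) z = w \<longleftrightarrow> z = (w - d (xi (k 0))) / c" for z w
  proof -
    have "branch (xi (k 0)) z = c * z + d (xi (k 0))" by (simp only: branch_def c_def)
    then show ?thesis by (auto simp: nonzero_eq_divide_eq[OF c] mult.commute)
  qed
  have "(\<lambda>n. nested (Suc n) k) \<longlonglongrightarrow> y"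
    using assms LIMSEQ_Suc[of "\<lambda>n. nested n k" y] unfolding is_mult_coding_def by blast
  then have "(\<lambda>n. (nested (Suc n) k - d (xi (k 0))) / c) \<longlonglongrightarrow> (y - d (xi (k 0))) / c"
    using c by (intro tendsto_intros)
  moreover have "(nested (Suc n) k - d (xi (k 0))) / c = nested n (\<lambda>i. k (Suc i))" for n
    by (rule sym) (rule iffD1[OF inv nested_Suc[of n k, symmetric]])
  ultimately have "(\<lambda>n. nested n (\<lambda>i. k (Suc i))) \<longlonglongrightarrow> (y - d (xi (k 0))) / c"
    by (simp only:)
  moreover have "branch (xi (k 0)) ((y - d (xi (k 0))) / c) = y" by (simp only: inv)
  moreover have "k (Suc i) \<in> {0, 1, 2, 3}" for i using assms unfolding is_mult_coding_def by blast
  ultimately show ?thesis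
    unfolding is_mult_coding_def by (intro exI[of _ "(y - d (xi (k 0))) / c"]) simp
qed

text \<open>Cutting the coding off after \<open>n\<close> digits replaces \<open>x n\<close> by \<open>0\<close> under \<open>n\<close> contractions, so it moves
  \<open>x 0\<close> by an amount that tends to \<open>0\<close> when the orbit is bounded.\<close>
lemma coding_from_orbit:
  assumes k: "\<And>i. k i \<in> {0, 1, 2, 3}"
    and x: "\<And>i. x i = branch (xi (k i)) (x (Suc i))" and bounded: "bounded (range x)"
  shows "is_mult_coding k (x 0)"
proof -
  have dist: "dist (nested n k) (x 0) = (tau\<^sup>2) ^ n * dist 0 (x n)"
    if "\<And>i. x i = branch (xi (k i)) (x (Suc i))" for n and k x
    using that
  proof (induction n arbitrary: k x)
    case 0
    show ?case by (simp only: nested.simps power_0 mult_1)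
  next
    case (Suc n)
    have "dist (nested (Suc n) k) (x 0)
      = dist (branch (xi (k 0)) (nested n (\<lambda>i. k (Suc i)))) (branch (xi (k 0)) (x (Suc 0)))"
      by (subst Suc.prems[of 0]) (simp only: nested_Suc)
    also have "\<dots> = tau\<^sup>2 * dist (nested n (\<lambda>i. k (Suc i))) (x (Suc 0))"
      by (rule branch_dist)
    also have "dist (nested n (\<lambda>i. k (Suc i))) (x (Suc 0)) = (tau\<^sup>2) ^ n * dist 0 (x (Suc n))"
      by (rule Suc.IH) (rule Suc.prems)
    finally show ?case by simp
  qed
  obtain B where B: "\<And>n. dist 0 (x n) \<le> B"
    using bounded unfolding bounded_any_center[where a = 0] by auto
  have "(\<lambda>n. (tau\<^sup>2) ^ n * B) \<longlonglongrightarrow> 0 * B"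
    using contraction_ratio by (intro tendsto_mult LIMSEQ_power_zero tendsto_const) auto
  then have lim: "(\<lambda>n. (tau\<^sup>2) ^ n * B) \<longlonglongrightarrow> 0" by simp
  have "dist (nested n k) (x 0) \<le> (tau\<^sup>2) ^ n * B" for n
  proof -
    have "dist (nested n k) (x 0) = (tau\<^sup>2) ^ n * dist 0 (x n)" by (rule dist) (rule x)
    then show ?thesis using B[of n] by (simp add: mult_left_mono)
  qed
  then have "(\<lambda>n. dist (nested n k) (x 0)) \<longlonglongrightarrow> 0"
    by (intro tendsto_sandwich[OF _ _ tendsto_const lim]) auto
  then have "(\<lambda>n. nested n k) \<longlonglongrightarrow> x 0" by (rule iffD2[OF tendsto_dist_iff])
  then show ?thesis using k unfolding is_mult_coding_def by blast
qed

lemma injective_on_finite_periodic: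
  assumes S: "finite S" "G ` S \<subseteq> S" "inj_on G S" and y: "y \<in> S"
  obtains p where "p \<ge> 1" "(G ^^ p) y = y"
proof -
  have orbit: "(G ^^ n) x \<in> S" if "x \<in> S" for n x using that S(2) by (induction n) auto
  have inj: "x = z" if "(G ^^ n) x = (G ^^ n) z" "x \<in> S" "z \<in> S" for n x z
    using that
  proof (induction n)
    case (Suc n)
    then show ?case using inj_onD[OF S(3), of "(G ^^ n) x" "(G ^^ n) z"] orbit by simp
  qed simp
  have "\<not> inj (\<lambda>n. (G ^^ n) y)"
  proof
    assume "inj (\<lambda>n. (G ^^ n) y)"
    moreover have "range (\<lambda>n. (G ^^ n) y) \<subseteq> S" using orbit[OF y] by auto
    ultimately show False using S(1) finite_imageD finite_subset infinite_UNIV_nat by metis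
  qed
  then obtain i j where "(G ^^ i) y = (G ^^ j) y" "i < j"
    unfolding inj_def by (metis linorder_neqE_nat)
  then have "(G ^^ i) y = (G ^^ i) ((G ^^ (j - i)) y)"
    by (metis comp_apply funpow_add le_add_diff_inverse less_imp_le)
  then have "(G ^^ (j - i)) y = y" using inj orbit[OF y] y by metis
  then show thesis using that[of "j - i"] \<open>i < j\<close> by simp
qed

section \<open>Pure periodicity and the dual attractor\<close>

text \<open>The conjugates are \<open>\<omega>\<^sup>2 * zeta\<^sup>2\<close>, \<open>- \<omega> * zeta\<^sup>2\<close> and \<open>zeta\<^sup>2 + \<omega>\<^sup>2 * zeta\<close>, the last of modulus at
  least \<open>\<omega>\<^sup>2 - 1 = \<omega>\<close>.\<close>
lemma conjugate_contact_norm: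
  assumes phi: "\<phi> \<in> Gal Q_zeta \<rat>" "\<phi> zeta = zeta\<^sup>2"
    and P: "P \<in> contact_points"
  shows "norm (\<phi> P) > 1"
proof -
  let ?s = "of_real (- 1 - tau) :: complex"
  have s: "norm ?s = 1 + tau" using tau_pos by (simp only: norm_of_real)
  have "conj_pair (of_real (tau ^ 2) * zeta) (?s ^ 2 * zeta\<^sup>2)"
    "conj_pair (of_real tau * zeta) (?s * zeta\<^sup>2)"
    "conj_pair (zeta + of_real (tau ^ 2) * zeta ^ 3) (zeta\<^sup>2 + ?s ^ 2 * (zeta\<^sup>2) ^ 3)"
    unfolding of_real_power
    by (intro conj_pair_add conj_pair_mult conj_pair_power conj_pair_tau conj_pair_zeta)+
  note conj = this[THEN Gal_conj_pair(2)[OF phi]]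
  have sq: "(1 + tau)\<^sup>2 = 2 + tau" by (simp add: power2_eq_square algebra_simps tau_sq)
  have "norm (zeta\<^sup>2 + ?s ^ 2 * (zeta\<^sup>2) ^ 3) \<ge> norm (?s ^ 2 * (zeta\<^sup>2) ^ 3) - norm (zeta\<^sup>2)"
    using norm_diff_ineq[of "?s ^ 2 * (zeta\<^sup>2) ^ 3" "zeta\<^sup>2"] by (simp only: add.commute)
  then have "norm (zeta\<^sup>2 + ?s ^ 2 * (zeta\<^sup>2) ^ 3) \<ge> 1 + tau"
    unfolding norm_mult norm_power s norm_zeta sq by simp
  moreover have "norm (?s ^ 2 * zeta\<^sup>2) = 2 + tau" "norm (?s * zeta\<^sup>2) = 1 + tau"
    unfolding norm_mult norm_power s norm_zeta sq by simp_all
  ultimately have "norm (\<phi> (of_real (tau ^ 2) * zeta)) > 1" "norm (\<phi> (of_real tau * zeta)) > 1"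
    "norm (\<phi> (zeta + of_real (tau ^ 2) * zeta ^ 3)) > 1"
    unfolding conj using tau_pos by linarith+
  then show ?thesis using P by blast
qed

lemma Gal_branch:
  assumes phi: "\<phi> \<in> Gal Q_zeta \<rat>" "\<phi> zeta = zeta\<^sup>2" and x: "x \<in> Q_zeta"
  shows "branch m x \<in> Q_zeta" "\<phi> (branch m x) = conj_branch m (\<phi> x)"
proof -
  obtain N where N: "N \<noteq> 0" "frac_pair N x (\<phi> x)" using Q_zeta_frac_pair[OF assms] by blast
  show "branch m x \<in> Q_zeta" "\<phi> (branch m x) = conj_branch m (\<phi> x)"
    using Gal_frac_pair[OF phi frac_pair_branch[OF N(2)] N(1)] by blast+
qed

text \<open>The conjugates of the tails of the coding form a finite set, contained in its own image
  under the dual branches.\<close>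
lemma purely_periodic_imp_dual:
  assumes phi: "\<phi> \<in> Gal Q_zeta \<rat>" "\<phi> zeta = zeta\<^sup>2" and y: "y \<in> Q_zeta"
    and k: "is_mult_coding k y" "purely_periodic k"
  shows "\<phi> y \<in> dual_attractor \<phi>"
proof -
  have digit: "\<phi> (d m) = conj_digit m" for m using Gal_conj_pair[OF phi conj_pair_digit] by blast
  note dual = dual_attractor_properties[of \<phi>, OF digit]
  obtain p where p: "p \<ge> 1" "\<And>i. k (i + p) = k i" using k(2) unfolding purely_periodic_def by blast
  define t where "t i = lim (\<lambda>n. nested n (\<lambda>j. k (j + i)))" for i
  have t: "is_mult_coding (\<lambda>j. k (j + i)) z \<Longrightarrow> t i = z" for i z
    unfolding is_mult_coding_def t_def by (auto intro: limI)
  have coding: "is_mult_coding (\<lambda>j. k (j + i)) (t i)" for i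
  proof (induction i)
    case 0
    then show ?case using k(1) t[of 0 y] by simp
  next
    case (Suc i)
    then show ?case using coding_tail[OF Suc] t[of "Suc i"] by auto
  qed
  have t_step: "t i = branch (xi (k i)) (t (Suc i))" for i
    using coding_tail[OF coding[of i]] t[of "Suc i"] by auto
  have t0: "t 0 = y" using t[of 0 y] k(1) by simp
  have tp: "t (i + p) = t i" for i
  proof -
    have "k (j + (i + p)) = k (j + i)" for j by (simp only: add.assoc[symmetric] p(2))
    then show ?thesis by (simp only: t_def)
  qed
  have tn: "t (i + n * p) = t i" for i n
  proof (induction n)
    case (Suc n)
    have "i + Suc n * p = (i + n * p) + p" by simp
    then show ?case by (simp only: tp Suc.IH)
  qed simp
  \<comment> \<open>By periodicity \<open>y\<close> is also a tail beyond \<open>t i\<close>, so \<open>t i\<close> is obtained from it by branches.\<close>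
  have Q: "t i \<in> Q_zeta" for i
  proof -
    have backwards: "t j \<in> Q_zeta" if "j \<le> n" "t n \<in> Q_zeta" for j n
      using that
    proof (induction rule: inc_induct)
      case (step j)
      then show ?case using Gal_branch(1)[OF phi] t_step[of j] by simp
    qed
    have "t (i * p) = y" using tn[of 0 i] t0 by simp
    then show ?thesis using backwards[of i "i * p"] y p(1) by simp
  qed
  define U where "U = range (\<lambda>i. \<phi> (t i))"
  have "U \<subseteq> (\<lambda>i. \<phi> (t i)) ` {..<p}"
  proof
    fix u assume "u \<in> U"
    then obtain i where "u = \<phi> (t i)" by (auto simp: U_def)
    then have "u = \<phi> (t (i mod p))" using tn[of "i mod p" "i div p"] by simp
    then show "u \<in> (\<lambda>i. \<phi> (t i)) ` {..<p}" using p(1) by simp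
  qed
  then have "bounded U" using finite_imp_bounded finite_subset by blast
  moreover have "U \<subseteq> (\<Union>m\<in>digits. dual_branch m ` U)"
  proof
    fix u assume "u \<in> U"
    then obtain i where i: "u = \<phi> (t i)" by (auto simp: U_def)
    \<comment> \<open>The cyclic predecessor of \<open>i\<close>; adding \<open>p\<close> first avoids index \<open>-1\<close>.\<close>
    define j where "j = i + p - 1"
    have "t (Suc j) = t i" using p(1) tp[of i] by (simp add: j_def)
    then have "\<phi> (t j) = conj_branch (xi (k j)) u"
      unfolding i t_step[of j] Gal_branch(2)[OF phi Q] by (simp only:)
    then have "u = dual_branch (xi (k j)) (\<phi> (t j))" by (simp add: dual_branch_conj)
    moreover have "xi (k j) \<in> digits"
      using k(1) xi_in_digits unfolding is_mult_coding_def by blast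
    ultimately show "u \<in> (\<Union>m\<in>digits. dual_branch m ` U)" unfolding U_def by blast
  qed
  ultimately have "U \<subseteq> dual_attractor \<phi>"
  proof (rule attractor_compare[where I = digits and f = dual_branch and r = "tau\<^sup>2", rotated 3])
    show "closed (dual_attractor \<phi>)" "dual_attractor \<phi> \<noteq> {}"
      "(\<Union>m\<in>digits. dual_branch m ` dual_attractor \<phi>) \<subseteq> dual_attractor \<phi>"
      using dual compact_imp_closed by blast+
  qed (simp_all add: dual_branch_dist contraction_ratio)
  then show ?thesis using t0 unfolding U_def by auto
qed

text \<open>A finite set of candidates around \<open>y\<close> is permuted by a choice of branches, and the cycle through
  \<open>y\<close>, read backward, is the coding.\<close>
lemma dual_imp_purely_periodic:
  assumes phi: "\<phi> \<in> Gal Q_zeta \<rat>" "\<phi> zeta = zeta\<^sup>2" and y: "y \<in> Y'" "y \<in> Q_zeta"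
    and dual_y: "\<phi> y \<in> dual_attractor \<phi>"
  shows "\<exists>k. is_mult_coding k y \<and> purely_periodic k"
proof -
  have digit: "\<phi> (d m) = conj_digit m" for m using Gal_conj_pair[OF phi conj_pair_digit] by blast
  note dual = dual_attractor_properties[of \<phi>, OF digit]
  note dual_ball = dual_attractor_bounded[of \<phi>, OF digit]
  obtain N where N: "N \<noteq> 0" "frac_pair N y (\<phi> y)" using Q_zeta_frac_pair[OF phi y(2)] by blast
  define S where "S = {x \<in> Y'. frac_pair N x (\<phi> x) \<and> \<phi> x \<in> dual_attractor \<phi>}"
  obtain B where B: "\<And>x. x \<in> Y' \<Longrightarrow> norm x \<le> B"
    using compact_imp_bounded[OF Y'_properties(2)] unfolding bounded_iff by blast
  have "S \<subseteq> {x. \<exists>x'. frac_pair N x x' \<and> norm x \<le> max B 1 \<and> norm x' \<le> max B 1}"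
    using B dual_ball by (force simp: S_def)
  then have fin: "finite S" using finite_frac_pairs[OF N(1)] finite_subset by blast
  have "\<exists>m\<in>digits. branch m x \<in> S" if "x \<in> S" for x
  proof -
    have x: "x \<in> Y'" "frac_pair N x (\<phi> x)" "\<phi> x \<in> dual_attractor \<phi>" using that by (auto simp: S_def)
    obtain m w where m: "m \<in> digits" "w \<in> dual_attractor \<phi>" "\<phi> x = dual_branch m w"
      using x(3) dual(3) by blast
    have f: "frac_pair N (branch m x) (conj_branch m (\<phi> x))" using x(2) by (rule frac_pair_branch)
    then have "\<phi> (branch m x) = conj_branch m (\<phi> x)" using Gal_frac_pair[OF phi f N(1)] by blast
    moreover have "conj_branch m (\<phi> x) = w" by (simp add: m(3) conj_branch_dual)
    moreover have "branch m x \<in> Y'" using Y'_properties(3) x(1) m(1) by blast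
    ultimately show ?thesis using f m by (auto simp: S_def)
  qed
  then have "\<forall>x\<in>S. \<exists>m. m \<in> digits \<and> branch m x \<in> S" by blast
  from bchoice[OF this] obtain g
    where "\<forall>x\<in>S. g x \<in> digits \<and> branch (g x) x \<in> S" ..
  then have g: "g x \<in> digits \<and> branch (g x) x \<in> S" if "x \<in> S" for x
    using that by (rule bspec)
  define G where "G x = branch (g x) x" for x
  have GS: "G ` S \<subseteq> S" using g by (auto simp: G_def)
  have inj: "inj_on G S"
  proof (rule inj_onI)
    fix x z assume xz: "x \<in> S" "z \<in> S" "G x = G z"
    show "x = z"
    proof (cases "g x = g z")
      case True
      then have "dist (branch (g x) x) (branch (g x) z) = 0" using xz by (simp add: G_def)
      then show ?thesis using tau_pos by (simp add: branch_dist)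
    next
      case False
      have "G x \<in> contact_points"
        unfolding G_def
        by (rule branch_overlap[of x z _ "g z"])
          (use xz g False Y'_subset_trapezoid in \<open>auto simp: S_def G_def\<close>)
      then have "norm (\<phi> (G x)) > 1" by (rule conjugate_contact_norm[OF phi])
      moreover have "\<phi> (G x) \<in> dual_attractor \<phi>" using GS xz(1) unfolding S_def by blast
      then have "\<phi> (G x) \<in> cball 0 1" using dual_ball by blast
      ultimately show ?thesis by simp
    qed
  qed
  have yS: "y \<in> S" using y N dual_y by (simp add: S_def)
  obtain q where q: "(G ^^ Suc q) y = y"
    using injective_on_finite_periodic[OF fin GS inj yS]
    by (metis One_nat_def Suc_le_D)
  \<comment> \<open>On the cycle of length \<open>Suc q\<close>, the inverse of \<open>G\<close> is \<open>G ^^ q\<close>.\<close>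
  define x where "x i = (G ^^ (i * q)) y" for i
  have xS: "x i \<in> S" for i
  proof -
    have "(G ^^ n) y \<in> S" for n using yS GS by (induction n) auto
    then show ?thesis by (simp add: x_def)
  qed
  have G_pred: "G (x (Suc i)) = x i" for i
  proof -
    have "G (x (Suc i)) = (G ^^ (i * q + Suc q)) y" by (simp add: x_def add.commute)
    also have "\<dots> = x i" by (simp only: funpow_add comp_apply q x_def)
    finally show ?thesis .
  qed
  have per: "x (i + Suc q) = x i" for i
  proof -
    have cycle: "(G ^^ (n * Suc q)) y = y" for n
    proof (induction n)
      case (Suc n)
      have "(G ^^ (Suc n * Suc q)) y = (G ^^ (n * Suc q)) ((G ^^ Suc q) y)"
        by (simp only: mult_Suc add.commute[of "Suc q"] funpow_add comp_apply)
      then show ?case by (simp only: q Suc.IH)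
    qed simp
    have "(i + Suc q) * q = i * q + q * Suc q" by (simp only: distrib_right mult.commute[of "Suc q"])
    then show ?thesis by (simp only: x_def funpow_add comp_apply cycle)
  qed
  have "\<forall>m\<in>digits. \<exists>k. k \<in> {0, 1, 2, 3} \<and> xi k = m" using digit_from_xi ..
  from bchoice[OF this] obtain ind
    where ind: "\<forall>m\<in>digits. ind m \<in> {0, 1, 2, 3} \<and> xi (ind m) = m" ..
  define k where "k i = ind (g (x (Suc i)))" for i
  have k: "k i \<in> {0, 1, 2, 3}" "xi (k i) = g (x (Suc i))" for i
    unfolding k_def using bspec[OF ind conjunct1[OF g[OF xS]]] by blast+
  have "is_mult_coding k (x 0)"
  proof (rule coding_from_orbit)
    show "x i = branch (xi (k i)) (x (Suc i))" for i
      unfolding k(2) using G_pred[of i] by (simp add: G_def)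
    show "bounded (range x)"
      by (rule bounded_subset[OF finite_imp_bounded[OF fin]]) (use xS in blast)
  qed (rule k(1))
  then have "is_mult_coding k y" by (simp add: x_def)
  moreover have "purely_periodic k"
    unfolding purely_periodic_def k_def 
  proof (intro exI[of _ "Suc q"] conjI allI)
    show "ind (g (x (Suc (i + Suc q)))) = ind (g (x (Suc i)))" for i
      using per[of "Suc i"] by (simp only: add_Suc)
  qed simp
  ultimately show ?thesis by blast
qed

theorem theorem6:
  fixes \<phi> :: "complex \<Rightarrow> complex" and y :: complex
  assumes "\<phi> \<in> Gal Q_zeta \<rat>"
    and "\<phi> zeta = zeta\<^sup>2"
    and "y \<in> Y' \<inter> Q_zeta"
  shows "(\<exists>k. is_mult_coding k y \<and> purely_periodic k) \<longleftrightarrow> (y, \<phi> y) \<in> Y' \<times> dual_attractor \<phi>"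
proof
  assume "\<exists>k. is_mult_coding k y \<and> purely_periodic k"
  then have "\<phi> y \<in> dual_attractor \<phi>"
    using purely_periodic_imp_dual[OF assms(1,2)] assms(3) by auto
  then show "(y, \<phi> y) \<in> Y' \<times> dual_attractor \<phi>" using assms(3) by auto
next
  assume "(y, \<phi> y) \<in> Y' \<times> dual_attractor \<phi>"
  then show "\<exists>k. is_mult_coding k y \<and> purely_periodic k"
    using dual_imp_purely_periodic[OF assms(1,2)] assms(3) by auto
qed

end
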